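(* Let $n\geq 1$, let $q\in(0,2]$, and let $f,g:\mathbb{R}\to\mathbb{R}$ be continuous nondecreasing functions, with $f$ positive and strictly increasing. Consider the equation $$\mathcal{M}^+_{0,1}(D^2u)=f(u)+g(u)\,|Du|^q\quad\text{in }\mathbb{R}^n .$$ \begin{itemize} \item[(i)] If $\lim_{t\to+\infty}g(t)>0$, then there exists an entire viscosity subsolution $u\in USC(\mathbb{R}^n)$ of this equation if and only if $$q\leq 1\quad\text{and}\quad \int_0^{+\infty}\frac{dt}{(t\,f(t))^{1/2}+(t\,g^+(t))^{1/(2-q)}}=+\infty .$$ \item[(ii)] If $\lim_{t\to+\infty}g(t)=0$, then there exists an entire viscosity subsolution $u\in USC(\mathbb{R}^n)$ of this equation if and only if $$\int_0^{+\infty}\frac{dt}{\left(\int_0^t e^{-2\int_s^t\left(\frac{g^-(\tau)}{f(\tau)}\right)^{2/q}f(\tau)\,d\tau}f(s)\,ds\right)^{1/2}}=+\infty .$$ \item[(iii)] If $\lim_{t\to+\infty}g(t)<0$, then there exists an entire viscosity subsolution $u\in USC(\mathbb{R}^n)$ of this equation if and only if $$\int_0^{+\infty}\left[\frac{1}{(t\,f(t))^{1/2}}+\frac{1}{f(t)^{1/q}}\right]dt=+\infty .$$ \end{itemize}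
   Context: $\mathcal{S}_n$ denotes the space of real symmetric $n\times n$ matrices. For $X\in\mathcal{S}_n$ with eigenvalues $\mu_1(X)\le\dots\le\mu_n(X)$, the degenerate maximal Pucci operator is $\mathcal{M}^+_{0,1}(X)=\sum_{\mu_i(X)>0}\mu_i(X)$. $g^+=\max(g,0)$, $g^-=\max(-g,0)$. $USC(\mathbb{R}^n)$ is the set of upper semicontinuous functions $\mathbb{R}^n\to\mathbb{R}$. A function $u\in USC(\mathbb{R}^n)$ is a viscosity subsolution of $\mathcal{M}^+_{0,1}(D^2u)=f(u)+g(u)|Du|^q$ if for every $x_0\in\mathbb{R}^n$ and every $\phi\in C^2$ such that $u-\phi$ has a local maximum at $x_0$ one has $\mathcal{M}^+_{0,1}(D^2\phi(x_0))\ge f(u(x_0))+g(u(x_0))|D\phi(x_0)|^q$. *)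

theory Defs
  imports "HOL-Analysis.Analysis" "HOL-Computational_Algebra.Polynomial"
begin

definition charpoly :: "real^'n^'n \<Rightarrow> real poly" where
  "charpoly X = det (\<chi> i j. (if i = j then [:0, 1:] else 0) - [:X $ i $ j:])"

text \<open>Degenerate maximal Pucci operator: sum of the positive eigenvalues
  (counted with multiplicity, i.e. as roots of the characteristic polynomial).
  For symmetric X all eigenvalues are real, so this is exactly the paper's M^+_{0,1}.\<close>
definition pucci_plus :: "real^'n^'n \<Rightarrow> real" where
  "pucci_plus X = sum_mset (filter_mset (\<lambda>\<mu>. 0 < \<mu>) (proots (charpoly X)))"

definition symmetric_matrix :: "real^'n^'n \<Rightarrow> bool" where
  "symmetric_matrix X \<longleftrightarrow> transpose X = X"

definition usc :: "(real^'n \<Rightarrow> real) \<Rightarrow> bool" where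
  "usc u \<longleftrightarrow> (\<forall>x c. u x < c \<longrightarrow> (\<forall>\<^sub>F y in at x. u y < c))"

definition C2_with :: "(real^'n \<Rightarrow> real) \<Rightarrow> (real^'n \<Rightarrow> real^'n) \<Rightarrow> (real^'n \<Rightarrow> real^'n^'n) \<Rightarrow> bool" where
  "C2_with phi Dphi D2phi \<longleftrightarrow>
     (\<forall>x. (phi has_derivative (\<lambda>h. Dphi x \<bullet> h)) (at x)) \<and>
     (\<forall>x. (Dphi has_derivative (\<lambda>h. D2phi x *v h)) (at x)) \<and>
     continuous_on UNIV D2phi"

definition local_max_at :: "(real^'n \<Rightarrow> real) \<Rightarrow> real^'n \<Rightarrow> bool" where
  "local_max_at w x0 \<longleftrightarrow> (\<exists>r>0. \<forall>y\<in>ball x0 r. w y \<le> w x0)"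

definition visc_subsol ::
  "(real \<Rightarrow> real) \<Rightarrow> (real \<Rightarrow> real) \<Rightarrow> real \<Rightarrow> (real^'n \<Rightarrow> real) \<Rightarrow> bool" where
  "visc_subsol f g q u \<longleftrightarrow> usc u \<and>
     (\<forall>x0 phi Dphi D2phi. C2_with phi Dphi D2phi \<and> local_max_at (\<lambda>y. u y - phi y) x0 \<longrightarrow>
        pucci_plus (D2phi x0) \<ge> f (u x0) + g (u x0) * norm (Dphi x0) powr q)"

end

theory Submission
  imports Defs
begin

text \<open>
  Write \<open>p\<close> for the slope of a one-dimensional profile as a function of its value, so that the
  profile solves \<open>H' = p(H)\<close>, \<open>H'' = p(H) p'(H)\<close>, and it is entire iff \<open>\<integral> dt / p(t)\<close> diverges.
  If \<open>p p' \<ge> f + g p\<^sup>q\<close> (or the right-hand side is nonpositive) and the integral diverges, then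
  \<open>u(x) = H(\<bar>x\<^sub>k\<bar>)\<close> is an entire subsolution: the convex kink at \<open>x\<^sub>k = 0\<close> cannot be touched from above.
  If \<open>(p p')\<^sup>+ + \<kappa> p \<le> f + g p\<^sup>q\<close> for a fixed \<open>\<kappa> > 0\<close> and the integral converges, a paraboloid
  on a ball of large radius \<open>R \<ge> n/\<kappa>\<close>, continued radially by \<open>H(\<bar>x\<bar> - R)\<close>, is a supersolution blowing up at
  finite distance; the monotonicity of \<open>f\<close> and \<open>g\<close> then excludes every subsolution. The curvature term
  \<open>(n - 1) p / \<bar>x\<bar>\<close> is absorbed by \<open>\<kappa> p\<close>.
  Each integral condition of the theorem decides between the two situations for an explicit \<open>p\<close>.
\<close>

section \<open>Linear algebra of the Pucci operator\<close>

text \<open>The quantifier order shapes the nonexistence part. \<open>R\<close> depends on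
  \<open>\<kappa>\<close>, the boundary slope of the paraboloid depends on \<open>R\<close>, and the
  profile must start below that slope: only then is the gluing sphere a concave kink, near which the
  paraboloid lies above and serves as test function. Hence families of profiles, arbitrarily small
  at \<open>A\<close>, with one common \<open>\<kappa>\<close>.

  Absorbing \<open>\<kappa> p\<close> is possible because of convergence itself: for nondecreasing
  \<open>p\<close>, a bounded integral of \<open>1 / p\<close> forces \<open>t \<le> B p(t)\<close>,
  and a bound of \<open>p\<^sup>2\<close> by \<open>t\<close> times the right-hand side then bounds
  \<open>p\<close> by the right-hand side. Only for \<open>q > 1\<close> with \<open>g\<close>
  eventually positive is a power of an affine function used directly.

  Where \<open>g > 0\<close>, the separate equations \<open>p p' = f\<close> and
  \<open>p p' = g p\<^sup>q\<close> integrate to \<open>p\<^sup>2 = 2 F\<close> and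
  \<open>p powr (2 - q) = (2 - q) G\<close>; the profiles combine the two. Where
  \<open>g \<le> 0\<close>, a linear equation for \<open>p\<^sup>2\<close> gives one criterion for
  every nonpositive limit; a negative limit makes \<open>w\<close> comparable with the minimum of
  \<open>t f\<close> and \<open>f powr (2 / q)\<close>, up to halving \<open>t\<close>.\<close>

lemma poly_det:
  fixes A :: "real poly^'n^'n"
  shows "poly (det A) x = det (\<chi> i j. poly (A $ i $ j) x)"
  by (simp add: det_def poly_sum poly_prod)

lemma poly_charpoly: "poly (charpoly X) c = det (mat c - X)"
proof -
  have "(\<chi> i j. poly ((if i = j then [:0, 1:] else 0) - [:X $ i $ j:]) c) = mat c - X"
    by (simp add: vec_eq_iff mat_def)
  then show ?thesis by (simp add: charpoly_def poly_det)
qed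

lemma mat_vector_mult: "mat c *v (v :: real^'n) = c *\<^sub>R v"
proof -
  have "mat c = c *\<^sub>R (mat 1 :: real^'n^'n)"
    by (simp add: vec_eq_iff mat_def)
  then show ?thesis
    by (metis matrix_vector_mul_lid scaleR_matrix_vector_assoc)
qed

lemma charpoly_root_iff: "poly (charpoly X) c = 0 \<longleftrightarrow> (\<exists>v\<noteq>0. X *v v = c *\<^sub>R v)"
proof -
  have "det (mat c - X) = 0 \<longleftrightarrow> (\<exists>v\<noteq>0. (mat c - X) *v v = 0)"
    by (metis invertible_det_nz invertible_left_inverse matrix_left_invertible_ker)
  then show ?thesis
    by (auto simp: poly_charpoly matrix_vector_mult_diff_rdistrib mat_vector_mult)
qed

section \<open>Rayleigh quotients and the largest eigenvalue\<close>

lemma quadratic_eq_zero_of_nonneg: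
  fixes a b :: real
  assumes "\<And>t. 0 \<le> a * t + b * t\<^sup>2"
  shows "a = 0"
proof (rule ccontr)
  assume "a \<noteq> 0"
  \<comment> \<open>\<open>c > \<bar>b\<bar>\<close> keeps \<open>c\<close> nonzero and leaves a
    margin: at \<open>t = - a / c\<close> the quadratic is at most
    \<open>- a\<^sup>2 / c\<^sup>2\<close>.\<close>
  define c where "c = \<bar>b\<bar> + 1"
  define t where "t = - a / c"
  have c: "c > 0" by (simp add: c_def)
  have "a * t + b * t\<^sup>2 \<le> a * t + (c - 1) * t\<^sup>2"
    by (simp add: mult_right_mono c_def)
  also have "\<dots> = - (a\<^sup>2 / c\<^sup>2)"
    using c by (simp add: t_def field_simps power2_eq_square)
  also have "\<dots> < 0" using \<open>a \<noteq> 0\<close> c by simp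
  finally show False using assms[of t] by simp
qed

lemma symmetric_matrix_dot:
  assumes "symmetric_matrix (X :: real^'n^'n)"
  shows "(X *v v) \<bullet> w = v \<bullet> (X *v w)"
  using assms by (metis dot_lmul_matrix symmetric_matrix_def transpose_matrix_vector)

text \<open>A maximiser \<open>v\<close> of the Rayleigh quotient on the unit sphere is an
  eigenvector: perturbing it by \<open>t *\<^sub>R w\<close> keeps
  \<open>c * (z \<bullet> z) - z \<bullet> (X *v z)\<close> nonnegative, so the term linear in
  \<open>t\<close> vanishes for every \<open>w\<close>.\<close>

lemma symmetric_max_eigenvalue:
  assumes "symmetric_matrix (X :: real^'n^'n)"
  obtains v c where "v \<noteq> 0" "X *v v = c *\<^sub>R v" "\<And>w. w \<bullet> (X *v w) \<le> c * (w \<bullet> w)"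
proof -
  let ?S = "sphere (0::real^'n) 1"
  have e: "axis undefined 1 \<in> ?S" by (simp add: norm_axis_1)
  have "continuous_on ?S (\<lambda>v. v \<bullet> (X *v v))"
    by (intro continuous_intros)
  then obtain v where v: "v \<in> ?S" "\<And>w. w \<in> ?S \<Longrightarrow> w \<bullet> (X *v w) \<le> v \<bullet> (X *v v)"
    using continuous_attains_sup[OF compact_sphere, of 0 1 "\<lambda>v. v \<bullet> (X *v v)"] e by blast
  define c where "c = v \<bullet> (X *v v)"
  have le: "w \<bullet> (X *v w) \<le> c * (w \<bullet> w)" for w
  proof (cases "w = 0")
    case False
    define u where "u = w /\<^sub>R norm w"
    have "w = norm w *\<^sub>R u" using False by (simp add: u_def)
    then have "w \<bullet> (X *v w) = (norm w)\<^sup>2 * (u \<bullet> (X *v u))"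
      by (metis (no_types, lifting) inner_scaleR_left inner_scaleR_right
          matrix_vector_mult_scaleR mult.assoc power2_eq_square)
    also have "\<dots> \<le> (norm w)\<^sup>2 * c"
      unfolding c_def using False by (intro mult_left_mono v) (auto simp: u_def)
    finally show ?thesis by (simp add: power2_norm_eq_inner mult.commute)
  qed (simp add: matrix_vector_mult_0_right)
  have vv: "v \<bullet> v = 1" using v(1) by (simp add: norm_eq_1)
  have "(c *\<^sub>R v - X *v v) \<bullet> w = 0" for w
  proof -
    have "0 \<le> (2 * ((c *\<^sub>R v - X *v v) \<bullet> w)) * t + (c * (w \<bullet> w) - w \<bullet> (X *v w)) * t\<^sup>2" for t
    proof -
      have vw: "v \<bullet> (X *v w) = w \<bullet> (X *v v)"
        by (metis assms inner_commute symmetric_matrix_dot)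
      have "0 \<le> c * ((v + t *\<^sub>R w) \<bullet> (v + t *\<^sub>R w)) - (v + t *\<^sub>R w) \<bullet> (X *v (v + t *\<^sub>R w))"
        using le by simp
      also have "\<dots> = (2 * ((c *\<^sub>R v - X *v v) \<bullet> w)) * t + (c * (w \<bullet> w) - w \<bullet> (X *v w)) * t\<^sup>2"
        using vv c_def
        by (simp add: matrix_vector_right_distrib matrix_vector_mult_scaleR inner_simps
            algebra_simps power2_eq_square inner_commute[of w v] vw inner_commute[of "X *v v" w])
      finally show ?thesis .
    qed
    then show ?thesis
      using quadratic_eq_zero_of_nonneg by fastforce
  qed
  then have "c *\<^sub>R v = X *v v"
    by (metis eq_iff_diff_eq_0 inner_eq_zero_iff)
  moreover have "v \<noteq> 0" using v(1) by auto
  ultimately show ?thesis using that le by metis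
qed

lemma sum_mset_pos_nonneg: "0 \<le> sum_mset (filter_mset (\<lambda>x. 0 < x) (M :: real multiset))"
  by (induction M) auto

lemma pucci_plus_nonneg: "0 \<le> pucci_plus X"
  unfolding pucci_plus_def by (rule sum_mset_pos_nonneg)

text \<open>The largest eigenvalue dominates the quadratic form on the unit sphere. If positive, it
  is one of the summands; otherwise nonnegativity of the sum is enough. Together with
  \<open>pucci_plus_nonneg\<close> this is all that the existence part uses of the operator.\<close>

lemma pucci_plus_ge_quadratic_form:
  assumes sym: "symmetric_matrix (X :: real^'n^'n)" and w: "norm w = 1"
  shows "w \<bullet> (X *v w) \<le> pucci_plus X"
proof -
  obtain v c where v: "v \<noteq> 0" "X *v v = c *\<^sub>R v" and le: "\<And>w. w \<bullet> (X *v w) \<le> c * (w \<bullet> w)"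
    using symmetric_max_eigenvalue[OF sym] by metis
  have wc: "w \<bullet> (X *v w) \<le> c" using le[of w] w by (simp add: norm_eq_1)
  show ?thesis
  proof (cases "c > 0")
    case True
    \<comment> \<open>Membership of \<open>c\<close> among the roots requires a nonzero polynomial;
      \<open>c + 1\<close> lies above every eigenvalue and so is not a root.\<close>
    have "poly (charpoly X) (c + 1) \<noteq> 0"
    proof
      assume "poly (charpoly X) (c + 1) = 0"
      then obtain y where "y \<noteq> 0" "X *v y = (c + 1) *\<^sub>R y" by (auto simp: charpoly_root_iff)
      then show False using le[of y] by (simp add: algebra_simps flip: inner_gt_zero_iff)
    qed
    then have nz: "charpoly X \<noteq> 0" by auto
    have "poly (charpoly X) c = 0" using v charpoly_root_iff by blast
    then have "c \<in># filter_mset (\<lambda>\<mu>. 0 < \<mu>) (proots (charpoly X))"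
      using nz True by simp
    then obtain M where M: "proots (charpoly X) = add_mset c M"
      by (metis insert_DiffM mem_Collect_eq set_mset_filter)
    then show ?thesis unfolding pucci_plus_def M using wc True sum_mset_pos_nonneg[of M] by simp
  next
    case False
    then show ?thesis using wc pucci_plus_nonneg[of X] by simp
  qed
qed

text \<open>An orthogonal \<open>P\<close> carrying a coordinate axis to the direction of
  \<open>x\<close> diagonalises the matrix, with \<open>a + b * (norm x)\<^sup>2\<close> once and
  \<open>a\<close> everywhere else. Hessians of radial functions have this form.\<close>

lemma poly_charpoly_rank_one:
  fixes x :: "real^'n"
  shows "poly (charpoly (\<chi> i j. (if i = j then a else 0) + b * (x $ i * x $ j))) c =
    (c - a) ^ (CARD('n) - 1) * (c - a - b * (norm x)\<^sup>2)"
proof -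
  let ?X = "\<chi> i j. (if i = j then a else 0) + b * (x $ i * x $ j)"
  obtain k :: 'n where True by blast
  have "norm x = norm (norm x *\<^sub>R axis k (1::real))" by (simp add: norm_axis_1)
  then obtain T where T: "orthogonal_transformation T" "T (norm x *\<^sub>R axis k (1::real)) = x"
    by (metis orthogonal_transformation_exists)
  define P where "P = matrix T"
  have P: "orthogonal_matrix P" and lin: "linear T"
    using T(1) by (auto simp: P_def orthogonal_transformation_matrix)
  have Px: "P *v (norm x *\<^sub>R axis k 1) = x" using T(2) lin by (simp add: P_def matrix_works)
  define D where "D = (\<chi> i j. if i = j then (c - a) - (if i = k then b * (norm x)\<^sup>2 else 0) else (0::real))"
  have Pk: "norm x * P $ i $ k = x $ i" for i
  proof -
    have "x $ i = (P *v (norm x *\<^sub>R axis k 1)) $ i" using Px by simp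
    also have "\<dots> = norm x * P $ i $ k"
      by (simp add: matrix_vector_mult_scaleR matrix_vector_mul_component inner_axis matrix_vector_mult_basis column_def)
    finally show ?thesis by simp
  qed
  have PP: "(\<Sum>l\<in>UNIV. P $ i $ l * P $ j $ l) = (if i = j then 1 else 0)" for i j
  proof -
    have "P ** transpose P = mat 1" using P by (simp add: orthogonal_matrix_def)
    then have "(P ** transpose P) $ i $ j = (mat 1 :: real^'n^'n) $ i $ j" by simp
    then show ?thesis by (simp add: matrix_matrix_mult_def transpose_def mat_def)
  qed
  have "mat c - ?X = P ** D ** transpose P"
  proof -
    have "(P ** D ** transpose P) $ i $ j = (mat c - ?X) $ i $ j" for i j
    proof -
      have "(P ** D) $ i $ l = P $ i $ l * ((c - a) - (if l = k then b * (norm x)\<^sup>2 else 0))" for l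
        by (simp add: matrix_matrix_mult_def D_def if_distrib cong: if_cong)
      then have "(P ** D ** transpose P) $ i $ j =
        (\<Sum>l\<in>UNIV. P $ i $ l * ((c - a) - (if l = k then b * (norm x)\<^sup>2 else 0)) * P $ j $ l)"
        by (simp add: matrix_matrix_mult_def[of "P ** D"] transpose_def)
      also have "\<dots> = (\<Sum>l\<in>UNIV. (c - a) * (P $ i $ l * P $ j $ l) -
          (if l = k then b * ((norm x * P $ i $ l) * (norm x * P $ j $ l)) else 0))"
        by (intro sum.cong refl) (simp add: algebra_simps power2_eq_square)
      also have "\<dots> = (c - a) * (if i = j then 1 else 0) - b * (x $ i * x $ j)"
        by (simp add: sum_subtractf sum_distrib_left[symmetric] PP Pk)
      also have "\<dots> = (mat c - ?X) $ i $ j" by (simp add: mat_def)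
      finally show ?thesis .
    qed
    then show ?thesis unfolding vec_eq_iff by metis
  qed
  then have "det (mat c - ?X) = det D"
    using det_orthogonal_matrix[OF P] by (auto simp: det_mul det_transpose)
  also have "\<dots> = (\<Prod>i\<in>UNIV. D $ i $ i)"
    by (rule det_diagonal) (simp add: D_def)
  also have "\<dots> = D $ k $ k * (\<Prod>i\<in>UNIV - {k}. D $ i $ i)"
    by (simp add: prod.remove)
  also have "(\<Prod>i\<in>UNIV - {k}. D $ i $ i) = (\<Prod>i\<in>UNIV - {k}. c - a)"
    by (intro prod.cong) (auto simp: D_def)
  also have "\<dots> = (c - a) ^ (CARD('n) - 1)" by (simp add: card_Diff_singleton)
  finally show ?thesis by (simp add: poly_charpoly D_def)
qed

lemma pucci_plus_rank_one:
  fixes x :: "real^'n"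
  assumes "0 \<le> a"
  shows "pucci_plus (\<chi> i j. (if i = j then a else 0) + b * (x $ i * x $ j)) =
    (real CARD('n) - 1) * a + max (a + b * (norm x)\<^sup>2) 0"
proof -
  let ?X = "\<chi> i j. (if i = j then a else 0) + b * (x $ i * x $ j)"
  let ?p = "[:- a, 1:] ^ (CARD('n) - 1) * [:- (a + b * (norm x)\<^sup>2), 1:]"
  have "poly (charpoly ?X) = poly ?p"
    by (rule ext) (simp add: poly_charpoly_rank_one algebra_simps)
  then have eq: "charpoly ?X = ?p" by (simp only: poly_eq_poly_eq_iff)
  have "proots ?p = repeat_mset (CARD('n) - 1) {#a#} + {#a + b * (norm x)\<^sup>2#}"
    by (subst proots_mult) (simp_all add: proots_power proots_linear_factor)
  then have "pucci_plus ?X = sum_mset (filter_mset (\<lambda>\<mu>. 0 < \<mu>) (replicate_mset (CARD('n) - 1) a))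
     + sum_mset (filter_mset (\<lambda>\<mu>. 0 < \<mu>) {#a + b * (norm x)\<^sup>2#})"
    by (simp add: pucci_plus_def eq repeat_mset_distrib2)
  moreover have "sum_mset (filter_mset (\<lambda>\<mu>. 0 < \<mu>) (replicate_mset (CARD('n) - 1) a)) = (real CARD('n) - 1) * a"
    proof -
    have "sum_mset (filter_mset (\<lambda>\<mu>. 0 < \<mu>) (replicate_mset m a)) = real m * a" for m
      using assms by (induction m) (auto simp: algebra_simps)
    then show ?thesis by (simp add: of_nat_diff Suc_leI)
  qed
  ultimately show ?thesis by (auto simp: max_def)
qed

section \<open>Symmetry of second derivatives\<close>

lemma C2_with_line_derivs:
  assumes "C2_with phi Dphi D2phi"
  shows "((\<lambda>s. phi (x + s *\<^sub>R v)) has_real_derivative Dphi (x + s *\<^sub>R v) \<bullet> v) (at s)"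
    and "((\<lambda>s. Dphi (x + s *\<^sub>R v) \<bullet> w) has_real_derivative (D2phi (x + s *\<^sub>R v) *v v) \<bullet> w) (at s)"
proof -
  have d: "(phi has_derivative (\<lambda>h. Dphi y \<bullet> h)) (at y)" "(Dphi has_derivative (\<lambda>h. D2phi y *v h)) (at y)" for y
    using assms by (auto simp: C2_with_def)
  have l: "((\<lambda>s. x + s *\<^sub>R v) has_derivative (\<lambda>r. r *\<^sub>R v)) (at s)"
    by (auto intro!: derivative_eq_intros)
  show "((\<lambda>s. phi (x + s *\<^sub>R v)) has_real_derivative Dphi (x + s *\<^sub>R v) \<bullet> v) (at s)"
    by (rule has_derivative_imp_has_field_derivative[OF has_derivative_compose[OF l d(1)]]) simp
  show "((\<lambda>s. Dphi (x + s *\<^sub>R v) \<bullet> w) has_real_derivative (D2phi (x + s *\<^sub>R v) *v v) \<bullet> w) (at s)"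
    by (rule has_derivative_imp_has_field_derivative[OF has_derivative_inner_left[OF has_derivative_compose[OF l d(2)]]])
      (simp add: matrix_vector_mult_scaleR)
qed

text \<open>Two applications of the mean value theorem, first along \<open>h\<close>, then along
  \<open>k\<close>. The intermediate point depends on the order, but it tends to \<open>x\<close>
  with \<open>t\<close>.\<close>

lemma C2_with_second_difference:
  assumes C2: "C2_with phi Dphi D2phi" and t: "0 < t"
  obtains y where "dist y x \<le> t * (norm h + norm k)"
    "phi (x + t *\<^sub>R h + t *\<^sub>R k) - phi (x + t *\<^sub>R h) - phi (x + t *\<^sub>R k) + phi x = t\<^sup>2 * ((D2phi y *v k) \<bullet> h)"
proof -
  define F where "F s = phi (x + s *\<^sub>R h + t *\<^sub>R k) - phi (x + s *\<^sub>R h)" for s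
  have "(F has_real_derivative Dphi (x + s *\<^sub>R h + t *\<^sub>R k) \<bullet> h - Dphi (x + s *\<^sub>R h) \<bullet> h) (at s)" for s
    unfolding F_def using C2_with_line_derivs(1)[OF C2, of "x + t *\<^sub>R k" h s] C2_with_line_derivs(1)[OF C2, of x h s]
    by (intro DERIV_diff) (simp_all add: add_ac)
  then obtain s where s: "0 < s" "s < t"
    and Fs: "F t - F 0 = t * (Dphi (x + s *\<^sub>R h + t *\<^sub>R k) \<bullet> h - Dphi (x + s *\<^sub>R h) \<bullet> h)"
    using MVT2[of 0 t F "\<lambda>s. Dphi (x + s *\<^sub>R h + t *\<^sub>R k) \<bullet> h - Dphi (x + s *\<^sub>R h) \<bullet> h"] t by auto
  define G where "G r = Dphi (x + s *\<^sub>R h + r *\<^sub>R k) \<bullet> h" for r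
  have "(G has_real_derivative (D2phi (x + s *\<^sub>R h + r *\<^sub>R k) *v k) \<bullet> h) (at r)" for r
    unfolding G_def by (rule C2_with_line_derivs(2)[OF C2])
  then obtain r where r: "0 < r" "r < t" and Gr: "G t - G 0 = t * ((D2phi (x + s *\<^sub>R h + r *\<^sub>R k) *v k) \<bullet> h)"
    using MVT2[of 0 t G "\<lambda>r. (D2phi (x + s *\<^sub>R h + r *\<^sub>R k) *v k) \<bullet> h"] t by auto
  show ?thesis
  proof
    have "dist (x + s *\<^sub>R h + r *\<^sub>R k) x = norm (s *\<^sub>R h + r *\<^sub>R k)" by (simp add: dist_norm add.assoc)
    also have "\<dots> \<le> s * norm h + r * norm k" using norm_triangle_ineq[of "s *\<^sub>R h" "r *\<^sub>R k"] s r by simp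
    also have "\<dots> \<le> t * (norm h + norm k)"
      using s r by (simp add: distrib_left add_mono mult_right_mono)
    finally show "dist (x + s *\<^sub>R h + r *\<^sub>R k) x \<le> t * (norm h + norm k)" .
    have "F t - F 0 = t * (G t - G 0)" using Fs by (simp add: G_def)
    then show "phi (x + t *\<^sub>R h + t *\<^sub>R k) - phi (x + t *\<^sub>R h) - phi (x + t *\<^sub>R k) + phi x
       = t\<^sup>2 * ((D2phi (x + s *\<^sub>R h + r *\<^sub>R k) *v k) \<bullet> h)"
      unfolding Gr by (simp add: F_def power2_eq_square algebra_simps)
  qed
qed

text \<open>\<open>C2_with\<close> says only that \<open>D2phi\<close> is the derivative of the
  gradient, whereas the Rayleigh bound concerns symmetric matrices. This is the Schwarz theorem: the
  mixed second difference is unchanged when \<open>h\<close> and \<open>k\<close> are exchanged, and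
  continuity of \<open>D2phi\<close> permits the limit.\<close>

lemma C2_with_symmetric:
  assumes C2: "C2_with phi Dphi D2phi"
  shows "symmetric_matrix (D2phi x)"
proof -
  have eq: "(D2phi x *v k) \<bullet> h = (D2phi x *v h) \<bullet> k" for h k
  proof -
    define t where "t n = inverse (real (Suc n))" for n
    define c where "c = norm h + norm k"
    have "\<exists>y z. dist y x \<le> t n * c \<and> dist z x \<le> t n * c \<and> (D2phi y *v k) \<bullet> h = (D2phi z *v h) \<bullet> k" for n
    proof -
      have t: "0 < t n" by (simp add: t_def)
      obtain y where y: "dist y x \<le> t n * (norm h + norm k)"
        "phi (x + t n *\<^sub>R h + t n *\<^sub>R k) - phi (x + t n *\<^sub>R h) - phi (x + t n *\<^sub>R k) + phi x = (t n)\<^sup>2 * ((D2phi y *v k) \<bullet> h)"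
        using C2_with_second_difference[OF C2 t] by metis
      obtain z where z: "dist z x \<le> t n * (norm k + norm h)"
        "phi (x + t n *\<^sub>R k + t n *\<^sub>R h) - phi (x + t n *\<^sub>R k) - phi (x + t n *\<^sub>R h) + phi x = (t n)\<^sup>2 * ((D2phi z *v h) \<bullet> k)"
        using C2_with_second_difference[OF C2 t] by metis
      have "x + t n *\<^sub>R k + t n *\<^sub>R h = x + t n *\<^sub>R h + t n *\<^sub>R k" by simp
      then have "(t n)\<^sup>2 * ((D2phi y *v k) \<bullet> h) = (t n)\<^sup>2 * ((D2phi z *v h) \<bullet> k)"
        unfolding y(2)[symmetric] z(2)[symmetric] by (simp add: add_ac)
      then have "(D2phi y *v k) \<bullet> h = (D2phi z *v h) \<bullet> k" using t by simp
      then show ?thesis using y z by (auto simp: c_def add.commute)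
    qed
    then obtain y z where yz: "\<And>n. dist (y n) x \<le> t n * c" "\<And>n. dist (z n) x \<le> t n * c"
      "\<And>n. (D2phi (y n) *v k) \<bullet> h = (D2phi (z n) *v h) \<bullet> k" by metis
    have "t \<longlonglongrightarrow> 0" unfolding t_def by (rule LIMSEQ_inverse_real_of_nat)
    then have t0: "(\<lambda>n. t n * c) \<longlonglongrightarrow> 0" by (rule tendsto_mult_left_zero)
    have lim: "w \<longlonglongrightarrow> x" if "\<And>n. dist (w n) x \<le> t n * c" for w
      using tendsto_sandwich[OF _ _ tendsto_const t0, of "\<lambda>n. dist (w n) x"] that tendsto_dist_iff by force
    have cont: "isCont D2phi x" using C2 by (simp add: C2_with_def continuous_on_eq_continuous_at)
    have "(\<lambda>n. (D2phi (w n) *v p) \<bullet> q) \<longlonglongrightarrow> (D2phi x *v p) \<bullet> q" if "w \<longlonglongrightarrow> x" for w p q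
    proof -
      have "(\<lambda>n. D2phi (w n)) \<longlonglongrightarrow> D2phi x" using cont that by (rule isCont_tendsto_compose)
      moreover have "isCont (\<lambda>A :: real^'a^'a. A *v p) (D2phi x)"
      proof -
        have "linear (\<lambda>A :: real^'a^'a. A *v p)"
          by (auto intro!: linearI simp: matrix_vector_mult_add_rdistrib scaleR_matrix_vector_assoc)
        then show ?thesis by (simp add: linear_continuous_at linear_conv_bounded_linear)
      qed
      ultimately have "(\<lambda>n. D2phi (w n) *v p) \<longlonglongrightarrow> D2phi x *v p"
        using isCont_tendsto_compose[of "D2phi x" "\<lambda>A. A *v p"] by fast
      then show ?thesis by (intro tendsto_intros)
    qed
    then have "(\<lambda>n. (D2phi (y n) *v k) \<bullet> h) \<longlonglongrightarrow> (D2phi x *v k) \<bullet> h"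
      "(\<lambda>n. (D2phi (z n) *v h) \<bullet> k) \<longlonglongrightarrow> (D2phi x *v h) \<bullet> k"
      using lim yz(1,2) by blast+
    then have "(\<lambda>n. (D2phi (z n) *v h) \<bullet> k) \<longlonglongrightarrow> (D2phi x *v k) \<bullet> h"
      "(\<lambda>n. (D2phi (z n) *v h) \<bullet> k) \<longlonglongrightarrow> (D2phi x *v h) \<bullet> k"
      by (simp_all add: yz(3))
    then show ?thesis by (rule LIMSEQ_unique)
  qed
  have "D2phi x $ i $ j = D2phi x $ j $ i" for i j
    using eq[of "axis j 1" "axis i 1"]
    by (simp add: matrix_vector_mult_basis inner_axis column_def)
  then show ?thesis by (simp add: symmetric_matrix_def transpose_def vec_eq_iff)
qed

section \<open>Entire subsolutions from one-dimensional profiles\<close>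

text \<open>\<open>H\<close> is the inverse of the time map, an antiderivative of
  \<open>1 / p\<close>. It lives on the whole line because the time map is onto: upwards by
  \<open>unb\<close>, downwards because \<open>p\<close> is constant below \<open>A\<close>.\<close>

lemma flow_exists:
  fixes p :: "real \<Rightarrow> real"
  assumes cont: "continuous_on UNIV p" and pos: "\<And>t. 0 < p t"
    and const: "\<And>t. t \<le> A \<Longrightarrow> p t = p A"
    and unb: "\<And>c. \<exists>t\<ge>A. c \<le> integral {A..t} (\<lambda>s. 1 / p s)"
  obtains H where "\<And>r. (H has_real_derivative p (H r)) (at r)"
    and "\<And>t. A \<le> t \<Longrightarrow> H (integral {A..t} (\<lambda>s. 1 / p s)) = t"
proof -
  have c1: "isCont (\<lambda>s. 1 / p s) x" for x
    using cont pos by (intro continuous_intros) (auto simp: continuous_on_eq_continuous_at less_imp_neq[symmetric])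
  obtain F where F: "\<And>x. (F has_vector_derivative 1 / p x) (at x)"
    using einterval_antiderivative[of "-\<infinity>" "\<infinity>" "\<lambda>s. 1 / p s"] c1 by auto
  then have F': "\<And>x. (F has_real_derivative 1 / p x) (at x)"
    by (simp add: has_real_derivative_iff_has_vector_derivative)
  have int: "integral {A..t} (\<lambda>s. 1 / p s) = F t - F A" if "A \<le> t" for t
    using fundamental_theorem_of_calculus[OF that, of F "\<lambda>s. 1 / p s"] F
    by (auto intro: has_vector_derivative_at_within integral_unique)
  have mono: "F x < F y" if "x < y" for x y
    using DERIV_pos_imp_increasing[OF that, of F] F' pos by (metis zero_less_divide_1_iff)
  then have inj: "inj F" by (metis injI linorder_neqE_linordered_idom order_less_irrefl)
  have cF: "continuous_on S F" for S
    using F' by (meson DERIV_isCont continuous_at_imp_continuous_on)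
  define \<Phi> where "\<Phi> t = F t - F A" for t
  have "\<exists>t. \<Phi> t = y" for y
  proof -
    obtain t1 where t1: "t1 \<ge> A" "y \<le> \<Phi> t1" using unb int unfolding \<Phi>_def by metis
    \<comment> \<open>Below \<open>A\<close> the time map is affine with slope
      \<open>1 / p A\<close>, so this point has time \<open>- (\<bar>y\<bar> + 1)\<close>.\<close>
    define t0 where "t0 = A - (\<bar>y\<bar> + 1) * p A"
    have "0 < (\<bar>y\<bar> + 1) * p A" using pos by simp
    then have "t0 < A" by (simp add: t0_def)
    then obtain z where z: "t0 < z" "z < A" "F A - F t0 = (A - t0) * (1 / p z)"
      using MVT2[of t0 A F "\<lambda>x. 1 / p x"] F' by auto
    then have "F A - F t0 = \<bar>y\<bar> + 1" using const[of z] pos[of A] by (simp add: t0_def)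
    then have "\<Phi> t0 \<le> y" by (simp add: \<Phi>_def)
    moreover have "continuous_on {t0..t1} \<Phi>" unfolding \<Phi>_def by (intro continuous_intros cF)
    ultimately show ?thesis using IVT'[of \<Phi> t0 y t1] t1 \<open>t0 < A\<close> by auto
  qed
  then obtain H where H: "\<And>y. \<Phi> (H y) = y" by metis
  have injP: "inj \<Phi>" using inj by (auto simp: inj_def \<Phi>_def)
  have HP: "H (\<Phi> t) = t" for t using H injP by (metis injD)
  have dP: "(\<Phi> has_real_derivative 1 / p x) (at x)" for x
    unfolding \<Phi>_def using F' by (auto intro!: derivative_eq_intros)
  have ic: "isCont \<Phi> z" for z using dP DERIV_isCont by blast
  have "isCont H (\<Phi> t)" for t
    by (rule isCont_inverse_function2[of "t - 1" t "t + 1"]) (use HP ic in auto)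
  then have cH: "isCont H y" for y by (metis H)
  have "(H has_real_derivative inverse (1 / p (H y))) (at y)" for y
    by (rule DERIV_inverse_function[of \<Phi> _ _ _ "y - 1" "y + 1"])
      (use H dP cH pos in \<open>auto simp: less_imp_neq[symmetric]\<close>)
  then show ?thesis using that[of H] HP int by (simp add: \<Phi>_def)
qed

section \<open>Second derivative tests in one variable\<close>

lemma second_derivative_nonpos_of_local_max:
  fixes W W' :: "real \<Rightarrow> real"
  assumes r: "0 < r" and d: "\<And>s. \<bar>s - x\<bar> < r \<Longrightarrow> (W has_real_derivative W' s) (at s)"
    and le: "\<And>s. \<bar>s - x\<bar> < r \<Longrightarrow> W s \<le> W x"
    and d2: "(W' has_real_derivative m) (at x)"
  shows "m \<le> 0"
proof (rule ccontr)
  assume "\<not> m \<le> 0"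
  have "W' x = 0" using DERIV_local_max[OF d r] le r by (simp add: abs_minus_commute)
  moreover obtain e where e: "e > 0" "\<And>h. 0 < h \<Longrightarrow> h < e \<Longrightarrow> W' x < W' (x + h)"
    using DERIV_pos_inc_right[OF d2] \<open>\<not> m \<le> 0\<close> by force
  ultimately have pos: "0 < W' s" if "x < s" "s < x + e" for s using that e(2)[of "s - x"] by simp
  define y where "y = x + min e r / 2"
  have y: "x < y" "y < x + e" "y < x + r" using e r by (auto simp: y_def)
  obtain z where z: "x < z" "z < y" "W y - W x = (y - x) * W' z"
    using MVT2[of x y W W'] y d by auto
  then have "0 < (y - x) * W' z" using pos y by (intro mult_pos_pos) auto
  then have "W y > W x" using z by simp
  then show False using le[of y] y by auto
qed

lemma local_max_of_second_derivative_neg: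
  fixes W W' :: "real \<Rightarrow> real"
  assumes r: "0 < r" and d: "\<And>s. \<bar>s - x\<bar> < r \<Longrightarrow> (W has_real_derivative W' s) (at s)"
    and "W' x = 0" "m < 0"
    and d2: "(W' has_real_derivative m) (at x)"
  obtains e where "0 < e" "\<And>s. \<bar>s - x\<bar> < e \<Longrightarrow> W s \<le> W x"
proof -
  obtain e1 where e1: "e1 > 0" "\<And>h. 0 < h \<Longrightarrow> h < e1 \<Longrightarrow> W' (x + h) < W' x"
    using DERIV_neg_dec_right[OF d2] \<open>m < 0\<close> by force
  obtain e2 where e2: "e2 > 0" "\<And>h. 0 < h \<Longrightarrow> h < e2 \<Longrightarrow> W' x < W' (x - h)"
    using DERIV_neg_dec_left[OF d2] \<open>m < 0\<close> by force
  define e where "e = min r (min e1 e2)"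
  have "W s \<le> W x" if s: "\<bar>s - x\<bar> < e" for s
  proof -
    consider "s = x" | "x < s" | "s < x" by linarith
    then show ?thesis
    proof cases
      case 2
      obtain z where z: "x < z" "z < s" "W s - W x = (s - x) * W' z"
        using MVT2[of x s W W'] 2 s d by (auto simp: e_def)
      then have "W' z \<le> 0" using e1(2)[of "z - x"] s assms by (auto simp: e_def)
      then have "(s - x) * W' z \<le> 0" using 2 by (simp add: mult_nonneg_nonpos)
      then show ?thesis using z by simp
    next
      case 3
      obtain z where z: "s < z" "z < x" "W x - W s = (x - s) * W' z"
        using MVT2[of s x W W'] 3 s d by (auto simp: e_def)
      then have "W' z \<ge> 0" using e2(2)[of "x - z"] s assms by (auto simp: e_def)
      then have "(x - s) * W' z \<ge> 0" using 3 by simp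
      then show ?thesis using z by simp
    qed simp
  qed
  moreover have "0 < e" using r e1 e2 by (simp add: e_def)
  ultimately show ?thesis using that by blast
qed

text \<open>Away from \<open>x $ k = 0\<close>, a touching test function has gradient of norm
  \<open>p t\<close> at the value \<open>t = u x0\<close>, and its second derivative along
  \<open>e\<close> is at least \<open>p t * D\<close>; this one direction suffices. In the first
  alternative of \<open>sub\<close>, nonnegativity of the operator is enough.\<close>

lemma visc_subsol_exists:
  fixes f g p :: "real \<Rightarrow> real"
  assumes cont: "continuous_on {A..} p" and pos: "\<And>t. A \<le> t \<Longrightarrow> 0 < p t"
    and unb: "\<And>c. \<exists>t\<ge>A. c \<le> integral {A..t} (\<lambda>s. 1 / p s)"
    and sub: "\<And>t. A < t \<Longrightarrow> f t + g t * p t powr q \<le> 0 \<or>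
      (\<exists>D. (p has_real_derivative D) (at t) \<and> f t + g t * p t powr q \<le> p t * D)"
  shows "\<exists>u :: real^'n \<Rightarrow> real. visc_subsol f g q u"
proof -
  \<comment> \<open>Freezing \<open>p\<close> below \<open>A\<close> makes the flow global; since
    \<open>H 0 = A\<close>, the function \<open>u\<close> takes only values at least
    \<open>A\<close>.\<close>
  define P where "P t = p (max t A)" for t
  have cP: "continuous_on UNIV P" unfolding P_def
    by (rule continuous_on_compose2[OF cont]) (auto intro!: continuous_intros)
  have posP: "0 < P t" for t by (simp add: P_def pos)
  have Pp: "P t = p t" if "A \<le> t" for t using that by (simp add: P_def max_def)
  have int: "integral {A..t} (\<lambda>s. 1 / P s) = integral {A..t} (\<lambda>s. 1 / p s)" for t
    by (rule integral_cong) (simp add: Pp)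
  obtain H where dH: "\<And>r. (H has_real_derivative P (H r)) (at r)"
    and H: "\<And>t. A \<le> t \<Longrightarrow> H (integral {A..t} (\<lambda>s. 1 / P s)) = t"
    using flow_exists[OF cP posP, of A] unb unfolding int by (auto simp: P_def)
  have H0: "H 0 = A" using H[of A] by simp
  have HA: "A < H r" if "0 < r" for r
    using DERIV_pos_imp_increasing[OF that, of H] dH posP H0 by metis
  obtain k :: 'n where True by blast
  define e :: "real^'n" where "e = axis k 1"
  have e1: "norm e = 1" and xe: "x \<bullet> e = x $ k" for x
    by (simp_all add: e_def norm_axis_1 inner_axis)
  have ek: "e $ k = 1" by (simp add: e_def)
  define u :: "real^'n \<Rightarrow> real" where "u x = H \<bar>x $ k\<bar>" for x
  have "isCont (\<lambda>x :: real^'n. \<bar>x $ k\<bar>) x" for x by (intro continuous_intros)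
  then have "isCont u x" for x unfolding u_def by (rule isCont_o2[OF _ DERIV_isCont[OF dH]])
  then have "usc u" unfolding usc_def by (auto simp: isCont_def intro: order_tendstoD(2))
  moreover have "pucci_plus (D2phi x0) \<ge> f (u x0) + g (u x0) * norm (Dphi x0) powr q"
    if C2: "C2_with phi Dphi D2phi" and lm: "local_max_at (\<lambda>y. u y - phi y) x0" for x0 phi Dphi D2phi
  proof -
    obtain r where r: "r > 0" and max: "\<And>y. y \<in> ball x0 r \<Longrightarrow> u y - phi y \<le> u x0 - phi x0"
      using lm by (auto simp: local_max_at_def)
    have line: "u (x0 + s *\<^sub>R v) - phi (x0 + s *\<^sub>R v) \<le> u x0 - phi x0" if "\<bar>s\<bar> * norm v < r" for s v
      using max[of "x0 + s *\<^sub>R v"] that by (simp add: dist_norm)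
    show ?thesis
    proof (cases "x0 $ k = 0")
      case True
      have F: "((\<lambda>s. phi (x0 + s *\<^sub>R e)) has_real_derivative Dphi x0 \<bullet> e) (at 0)"
        using C2_with_line_derivs(1)[OF C2, of x0 e 0] by simp
      have der1: "((\<lambda>s. H s - phi (x0 + s *\<^sub>R e)) has_real_derivative P (H 0) - Dphi x0 \<bullet> e) (at 0)"
        by (intro DERIV_diff dH F)
      have der2: "((\<lambda>s. H (- s) - phi (x0 + s *\<^sub>R e)) has_real_derivative - P (H 0) - Dphi x0 \<bullet> e) (at 0)"
        by (intro DERIV_diff F) (use DERIV_chain2[OF dH[of "- 0"] DERIV_minus[OF DERIV_ident, of 0 UNIV]] in simp)
      \<comment> \<open>Along \<open>e\<close> these are the one-sided slopes of
        \<open>u - phi\<close> to the right and to the left of the kink. They differ by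
        \<open>2 * P (H 0) > 0\<close>, so \<open>u - phi\<close> increases strictly in one of the
        two directions.\<close>
      consider "0 < P (H 0) - Dphi x0 \<bullet> e" | "- P (H 0) - Dphi x0 \<bullet> e < 0" using posP[of "H 0"] by linarith
      then have False
      proof cases
        case 1
        obtain d where "d > 0" and d: "\<And>h. 0 < h \<Longrightarrow> h < d \<Longrightarrow> H 0 - phi (x0 + 0 *\<^sub>R e) < H (0 + h) - phi (x0 + (0 + h) *\<^sub>R e)"
          using DERIV_pos_inc_right[OF der1 1] by blast
        define s where "s = min d r / 2"
        have "0 < s" "s < d" "s < r" using r \<open>d > 0\<close> by (auto simp: s_def)
        then show False
          using d[of s] line[of "s" e] True e1 by (simp add: u_def ek)
      next
        case 2
        obtain d where "d > 0" and d: "\<And>h. 0 < h \<Longrightarrow> h < d \<Longrightarrow> H (- 0) - phi (x0 + 0 *\<^sub>R e) < H (- (0 - h)) - phi (x0 + (0 - h) *\<^sub>R e)"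
          using DERIV_neg_dec_left[OF der2 2] by blast
        define s where "s = min d r / 2"
        have "0 < s" "s < d" "s < r" using r \<open>d > 0\<close> by (auto simp: s_def)
        then show False
          using d[of s] line[of "- s" e] True e1 by (simp add: u_def ek)
      qed
      then show ?thesis ..
    next
      case False
      define \<sigma> where "\<sigma> = sgn (x0 $ k)"
      have \<sigma>: "\<sigma> * \<sigma> = 1" "\<bar>\<sigma>\<bar> = 1" using False by (auto simp: \<sigma>_def sgn_if)
      define t where "t = H \<bar>x0 $ k\<bar>"
      have tA: "A < t" unfolding t_def using HA False by simp
      have ut: "u x0 = t" by (simp add: u_def t_def)
      have abs: "\<bar>x0 $ k + h\<bar> = \<sigma> * (x0 $ k + h)" if "\<bar>h\<bar> < \<bar>x0 $ k\<bar>" for h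
        using that by (auto simp: \<sigma>_def sgn_if)
      have abs0: "\<bar>x0 $ k\<bar> = \<sigma> * x0 $ k" using abs[of 0] False by simp
      have dline: "((\<lambda>s. H (\<sigma> * (x0 $ k + s * c))) has_real_derivative \<sigma> * c * P (H (\<sigma> * (x0 $ k + s * c)))) (at s)" for s c
      proof -
        have "((\<lambda>s. \<sigma> * (x0 $ k + s * c)) has_real_derivative \<sigma> * c) (at s)"
          by (auto intro!: derivative_eq_intros)
        from DERIV_chain2[OF dH this] show ?thesis by (rule DERIV_cong) (rule mult.commute)
      qed
      define W where "W v s = H (\<sigma> * (x0 $ k + s * v $ k)) - phi (x0 + s *\<^sub>R v)" for v s
      define W' where "W' v s = \<sigma> * v $ k * P (H (\<sigma> * (x0 $ k + s * v $ k))) - Dphi (x0 + s *\<^sub>R v) \<bullet> v" for v s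
      have dW: "(W v has_real_derivative W' v s) (at s)" for v s
        unfolding W_def W'_def by (intro DERIV_diff dline C2_with_line_derivs(1)[OF C2])
      have W0: "W v 0 = u x0 - phi x0" for v by (simp add: W_def u_def abs0)
      have Wmax: "\<exists>d>0. \<forall>s. \<bar>0 - s\<bar> < d \<longrightarrow> W v s \<le> W v 0" for v
      proof -
        \<comment> \<open>The bound by \<open>\<bar>x0 $ k\<bar>\<close> keeps the segment on one
          side of the kink; \<open>+ 1\<close> covers \<open>v = 0\<close>.\<close>
        define d where "d = min r \<bar>x0 $ k\<bar> / (norm v + 1)"
        have dp: "d > 0" using r False by (auto simp: d_def intro!: divide_pos_pos add_nonneg_pos)
        have "W v s \<le> W v 0" if "\<bar>s\<bar> < d" for s
        proof -
          have "\<bar>s\<bar> * (norm v + 1) < min r \<bar>x0 $ k\<bar>"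
            using that unfolding d_def by (subst (asm) pos_less_divide_eq) (auto intro: add_nonneg_pos)
          then have sv: "\<bar>s\<bar> * norm v < r" "\<bar>s\<bar> * norm v < \<bar>x0 $ k\<bar>"
            using abs_ge_zero[of s] unfolding distrib_left by linarith+
          have "\<bar>s * v $ k\<bar> \<le> \<bar>s\<bar> * norm v"
            by (simp add: abs_mult mult_left_mono component_le_norm_cart)
          then have "\<bar>s * v $ k\<bar> < \<bar>x0 $ k\<bar>" using sv by simp
          then have "u (x0 + s *\<^sub>R v) = H (\<sigma> * (x0 $ k + s * v $ k))"
            using abs by (simp add: u_def)
          then show ?thesis using line[OF sv(1)] unfolding W0 by (simp add: W_def)
        qed
        then show ?thesis using dp by auto
      qed
      have W'0: "W' v 0 = 0" for v using DERIV_local_max[OF dW[of v 0]] Wmax[of v] by blast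
      have "Dphi x0 \<bullet> v = (\<sigma> * P t) *\<^sub>R e \<bullet> v" for v
        using W'0[of v] by (simp add: W'_def t_def abs0 inner_commute[of e] xe mult_ac)
      then have "Dphi x0 = (\<sigma> * P t) *\<^sub>R e" using vector_eq_rdot by blast
      then have nD: "norm (Dphi x0) = p t" using e1 \<sigma> posP[of t] Pp tA by (simp add: abs_mult)
      show ?thesis
      proof (cases "f t + g t * p t powr q \<le> 0")
        case True
        then show ?thesis unfolding nD ut using pucci_plus_nonneg order_trans by blast
      next
        case False
        then obtain D where D: "(p has_real_derivative D) (at t)" "f t + g t * p t powr q \<le> p t * D"
          using sub[OF tA] by blast
        have DP: "(P has_real_derivative D) (at t)"
          by (rule has_field_derivative_transform_within_open[OF D(1), of "{A<..}"]) (use tA Pp in auto)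
        have tt: "H (\<sigma> * (x0 $ k + 0 * 1)) = t" by (simp add: t_def abs0)
        have "((\<lambda>s. P (H (\<sigma> * (x0 $ k + s * 1)))) has_real_derivative D * (\<sigma> * 1 * P t)) (at 0)"
          using DERIV_chain2[of P D "\<lambda>s. H (\<sigma> * (x0 $ k + s * 1))" 0, OF _ dline[of 1 0]] DP
          unfolding tt by blast
        then have A: "((\<lambda>s. \<sigma> * (P (H (\<sigma> * (x0 $ k + s * 1)))) - Dphi (x0 + s *\<^sub>R e) \<bullet> e) has_real_derivative
            \<sigma> * (D * (\<sigma> * 1 * P t)) - (D2phi (x0 + 0 *\<^sub>R e) *v e) \<bullet> e) (at 0)"
          by (intro DERIV_diff C2_with_line_derivs(2)[OF C2] DERIV_cmult)
        have B: "W' e = (\<lambda>s. \<sigma> * (P (H (\<sigma> * (x0 $ k + s * 1)))) - Dphi (x0 + s *\<^sub>R e) \<bullet> e)"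
          by (rule ext) (simp add: W'_def ek)
        have C: "\<sigma> * (D * (\<sigma> * 1 * P t)) = p t * D"
        proof -
          have "\<sigma> * (D * (\<sigma> * 1 * P t)) = (\<sigma> * \<sigma>) * (P t * D)" by simp
          then show ?thesis using \<sigma> Pp tA by simp
        qed
        have dW': "(W' e has_real_derivative p t * D - e \<bullet> (D2phi x0 *v e)) (at 0)"
          using A unfolding B[symmetric] C by (simp add: inner_commute[of e])
        obtain d where d: "d > 0" "\<And>s. \<bar>s\<bar> < d \<Longrightarrow> W e s \<le> W e 0" using Wmax[of e] by auto
        have "p t * D - e \<bullet> (D2phi x0 *v e) \<le> 0"
          by (rule second_derivative_nonpos_of_local_max[OF d(1) _ _ dW', of "W e"]) (use d dW in auto)
        then have "f t + g t * p t powr q \<le> e \<bullet> (D2phi x0 *v e)" using D(2) by simp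
        also have "\<dots> \<le> pucci_plus (D2phi x0)"
          by (rule pucci_plus_ge_quadratic_form[OF C2_with_symmetric[OF C2] e1])
        finally show ?thesis unfolding nD ut .
      qed
    qed
  qed
  ultimately show ?thesis unfolding visc_subsol_def by blast
qed

section \<open>Comparison with radial supersolutions\<close>

text \<open>Otherwise every \<open>x\<close> in \<open>K\<close> has a strictly better point
  \<open>Y x\<close> and, by upper semicontinuity, a neighbourhood on which \<open>w\<close> stays
  below \<open>w (Y x)\<close>. Over a finite subcover, the largest \<open>w (Y c)\<close> would lie
  below another one.\<close>

lemma usc_attains_max:
  fixes w :: "real^'n \<Rightarrow> real"
  assumes usc: "usc w" and K: "compact K" "K \<noteq> {}"
  obtains x where "x \<in> K" "\<And>y. y \<in> K \<Longrightarrow> w y \<le> w x"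
proof (rule ccontr)
  assume no: "\<not> thesis"
  have "\<forall>x\<in>K. \<exists>y\<in>K. w x < w y" using no that by force
  then obtain Y where Y: "\<And>x. x \<in> K \<Longrightarrow> Y x \<in> K \<and> w x < w (Y x)" by metis
  have "\<exists>U. open U \<and> x \<in> U \<and> (\<forall>z\<in>U. w z < w (Y x))" if "x \<in> K" for x
  proof -
    have "\<forall>\<^sub>F z in at x. w z < w (Y x)" using usc Y that by (simp add: usc_def)
    then obtain U where "open U" "x \<in> U" "\<forall>z\<in>U. z \<noteq> x \<longrightarrow> w z < w (Y x)"
      by (auto simp: eventually_at_topological)
    then show ?thesis using Y[OF that] by metis
  qed
  then obtain U where U: "\<And>x. x \<in> K \<Longrightarrow> open (U x) \<and> x \<in> U x \<and> (\<forall>z\<in>U x. w z < w (Y x))" by metis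
  then obtain C where C: "C \<subseteq> K" "finite C" "K \<subseteq> (\<Union>c\<in>C. U c)"
    using compactE_image[OF K(1), of K U] by (metis UN_iff subsetI)
  then have "C \<noteq> {}" using K by auto
  then have "Max ((\<lambda>c. w (Y c)) ` C) \<in> (\<lambda>c. w (Y c)) ` C" using C(2) by (intro Max_in) auto
  then obtain c where c: "c \<in> C" and Mc: "Max ((\<lambda>c. w (Y c)) ` C) = w (Y c)" by blast
  have "Y c \<in> K" using c C Y by blast
  then obtain c' where "c' \<in> C" "Y c \<in> U c'" using C by blast
  then have "w (Y c) < w (Y c')" using U C by blast
  moreover have "w (Y c') \<le> w (Y c)"
    unfolding Mc[symmetric] using C(2) \<open>c' \<in> C\<close> by (intro Max_ge) auto
  ultimately show False by simp
qed

lemma usc_diff_continuous: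
  fixes u v :: "real^'n \<Rightarrow> real"
  assumes u: "usc u" and v: "continuous_on UNIV v"
  shows "usc (\<lambda>x. u x - v x)"
  unfolding usc_def
proof (intro allI impI)
  fix x c assume c: "u x - v x < c"
  define e where "e = (c - (u x - v x)) / 2"
  have e: "e > 0" using c by (simp add: e_def)
  have 1: "\<forall>\<^sub>F y in at x. u y < u x + e" using u e by (simp add: usc_def)
  have "(v \<longlongrightarrow> v x) (at x)" using v by (simp add: continuous_on_def)
  then have 2: "\<forall>\<^sub>F y in at x. v x - e < v y" using e by (auto intro: order_tendstoD(1))
  show "\<forall>\<^sub>F y in at x. u y - v y < c"
    using 1 2 by eventually_elim (simp add: e_def field_simps)
qed

text \<open>\<open>C2_with\<close> demands smoothness on the whole space, while a function of
  \<open>norm x\<close> is in general not smooth at the origin. Polynomials in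
  \<open>(norm x)\<^sup>2\<close> are; \<open>c\<close>, \<open>b\<close> and \<open>d\<close>
  prescribe value, first and second derivative in that variable at \<open>s0\<close>.\<close>

lemma C2_with_radial_quartic:
  fixes c b d s0 :: real
  shows "C2_with (\<lambda>x :: real^'n. c + b * ((norm x)\<^sup>2 - s0) + d / 2 * ((norm x)\<^sup>2 - s0)\<^sup>2)
    (\<lambda>x. (2 * b + 2 * d * ((norm x)\<^sup>2 - s0)) *\<^sub>R x)
    (\<lambda>x. \<chi> i j. (if i = j then 2 * b + 2 * d * ((norm x)\<^sup>2 - s0) else 0) + 4 * d * (x $ i * x $ j))"
  unfolding C2_with_def
proof (intro conjI allI)
  fix x :: "real^'n"
  have n: "((\<lambda>x :: real^'n. (norm x)\<^sup>2) has_derivative (\<lambda>h. 2 * (x \<bullet> h))) (at x)"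
    unfolding power2_norm_eq_inner
    by (auto intro!: derivative_eq_intros simp: inner_commute)
  show "((\<lambda>x :: real^'n. c + b * ((norm x)\<^sup>2 - s0) + d / 2 * ((norm x)\<^sup>2 - s0)\<^sup>2) has_derivative
     (\<lambda>h. (2 * b + 2 * d * ((norm x)\<^sup>2 - s0)) *\<^sub>R x \<bullet> h)) (at x)"
    by (rule has_derivative_eq_rhs, (rule derivative_intros n)+) (auto simp: fun_eq_iff algebra_simps)
  have mv: "(\<chi> i j. (if i = j then a else 0) + m * (x $ i * x $ j)) *v h = a *\<^sub>R h + (m * (x \<bullet> h)) *\<^sub>R x" for a m h
  proof -
    have "(\<Sum>j\<in>UNIV. h $ j * (if i = j then a else 0)) = a * h $ i" for i
      by (simp add: if_distrib[of "\<lambda>z. _ * z"] cong: if_cong)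
    then show ?thesis
      by (simp add: vec_eq_iff matrix_vector_mult_def distrib_right sum.distrib
          inner_vec_def sum_distrib_left sum_distrib_right algebra_simps)
  qed
  show "((\<lambda>x :: real^'n. (2 * b + 2 * d * ((norm x)\<^sup>2 - s0)) *\<^sub>R x) has_derivative
     (\<lambda>h. (\<chi> i j. (if i = j then 2 * b + 2 * d * ((norm x)\<^sup>2 - s0) else 0) + 4 * d * (x $ i * x $ j)) *v h)) (at x)"
    unfolding mv
    by (rule has_derivative_eq_rhs, (rule derivative_intros n)+) (auto simp: fun_eq_iff algebra_simps)
next
  show "continuous_on UNIV (\<lambda>x :: real^'n. \<chi> i j. (if i = j then 2 * b + 2 * d * ((norm x)\<^sup>2 - s0) else 0) + 4 * d * (x $ i * x $ j))"
  proof (intro continuous_on_vec_lambda)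
    fix i j
    show "continuous_on UNIV (\<lambda>x :: real^'n. (if i = j then 2 * b + 2 * d * ((norm x)\<^sup>2 - s0) else 0) + 4 * d * (x $ i * x $ j))"
      by (cases "i = j") (auto intro!: continuous_intros)
  qed
qed

lemma visc_subsol_quartic_test:
  fixes u :: "real^'n \<Rightarrow> real"
  assumes u: "visc_subsol f g q u"
    and lm: "local_max_at (\<lambda>y. u y - (c + b * ((norm y)\<^sup>2 - (norm x)\<^sup>2) + d / 2 * ((norm y)\<^sup>2 - (norm x)\<^sup>2)\<^sup>2)) x"
    and b: "0 \<le> b"
  shows "f (u x) + g (u x) * (2 * b * norm x) powr q
    \<le> (real CARD('n) - 1) * (2 * b) + max (2 * b + 4 * d * (norm x)\<^sup>2) 0"
proof -
  let ?s = "(norm x)\<^sup>2"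
  have "f (u x) + g (u x) * norm ((2 * b + 2 * d * (?s - ?s)) *\<^sub>R x) powr q \<le>
    pucci_plus (\<chi> i j. (if i = j then 2 * b + 2 * d * (?s - ?s) else 0) + 4 * d * (x $ i * x $ j))"
    using u lm C2_with_radial_quartic[of c b ?s d] unfolding visc_subsol_def by blast
  also have "\<dots> = (real CARD('n) - 1) * (2 * b) + max (2 * b + 4 * d * ?s) 0"
    using b by (subst pucci_plus_rank_one) auto
  finally show ?thesis using b by (simp add: abs_mult)
qed

text \<open>The function \<open>h\<close> is controlled only near \<open>norm x\<close>. In the
  variable \<open>s = (norm y)\<^sup>2\<close>, its second-order Taylor polynomial with the second
  derivative raised by \<open>e\<close> lies above it locally and is an admissible test function;
  the excess disappears as \<open>\<epsilon>\<close> tends to 0.\<close>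

lemma visc_subsol_radial_test:
  fixes u :: "real^'n \<Rightarrow> real"
  assumes u: "visc_subsol f g q u"
    and lm: "local_max_at (\<lambda>y. u y - h (norm y)) x"
    and x: "x \<noteq> 0" and \<rho>: "0 < \<rho>"
    and dh: "\<And>r. \<bar>r - norm x\<bar> < \<rho> \<Longrightarrow> (h has_real_derivative h' r) (at r)"
    and dh': "(h' has_real_derivative m) (at (norm x))"
    and nn: "0 \<le> h' (norm x)"
  shows "f (u x) + g (u x) * h' (norm x) powr q
    \<le> (real CARD('n) - 1) * (h' (norm x) / norm x) + max m 0"
proof (rule field_le_epsilon)
  fix \<epsilon> :: real assume \<epsilon>: "0 < \<epsilon>"
  define r where "r = norm x"
  have r: "0 < r" using x by (simp add: r_def)
  \<comment> \<open>\<open>b\<close> and \<open>K\<close> below are the first and second derivatives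
    of \<open>h (sqrt s)\<close> at \<open>s = r\<^sup>2\<close>, so
    \<open>2 * b + 4 * K * r\<^sup>2 = m\<close>; raising \<open>K\<close> by \<open>e\<close> adds
    exactly \<open>\<epsilon>\<close>.\<close>
  define e where "e = \<epsilon> / (4 * r\<^sup>2)"
  have e: "e > 0" using \<epsilon> r by (simp add: e_def)
  define b where "b = h' r / (2 * r)"
  define K where "K = m / (4 * r\<^sup>2) - h' r / (4 * r ^ 3)"
  define k where "k s = h (sqrt s)" for s
  define k' where "k' s = h' (sqrt s) / (2 * sqrt s)" for s
  have sr: "sqrt (r\<^sup>2) = r" using r by simp
  have "isCont sqrt (r\<^sup>2)" by (rule isCont_real_sqrt)
  then have "\<forall>\<^sub>F s in at (r\<^sup>2). \<bar>sqrt s - r\<bar> < \<rho>"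
    using \<rho> unfolding isCont_def sr by (auto dest!: tendstoD simp: dist_real_def)
  then obtain d0 where d0: "d0 > 0" "\<And>s. s \<noteq> r\<^sup>2 \<Longrightarrow> \<bar>s - r\<^sup>2\<bar> < d0 \<Longrightarrow> \<bar>sqrt s - r\<bar> < \<rho>"
    by (auto simp: eventually_at dist_real_def)
  define d1 where "d1 = min d0 (r\<^sup>2)"
  have d1: "d1 > 0" using d0 r by (simp add: d1_def)
  have near: "0 < s" "\<bar>sqrt s - r\<bar> < \<rho>" if "\<bar>s - r\<^sup>2\<bar> < d1" for s
    using that d0 \<rho> sr by (cases "s = r\<^sup>2"; auto simp: d1_def)+
  have dk: "(k has_real_derivative k' s) (at s)" if "\<bar>s - r\<^sup>2\<bar> < d1" for s
    unfolding k_def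
    by (rule DERIV_cong[OF DERIV_chain2[OF dh DERIV_real_sqrt]])
      (use near[OF that] in \<open>auto simp: k'_def r_def field_simps\<close>)
  have dk': "(k' has_real_derivative K) (at (r\<^sup>2))"
  proof -
    have dh's: "((\<lambda>s. h' (sqrt s)) has_real_derivative m * (inverse (sqrt (r\<^sup>2)) / 2)) (at (r\<^sup>2))"
      by (rule DERIV_chain2[OF _ DERIV_real_sqrt]) (use dh' r in \<open>auto simp: sr r_def\<close>)
    have ds: "((\<lambda>s. 2 * sqrt s) has_real_derivative 2 * (inverse (sqrt (r\<^sup>2)) / 2)) (at (r\<^sup>2))"
      by (intro DERIV_cmult DERIV_real_sqrt) (use r in auto)
    show ?thesis unfolding k'_def
      by (rule DERIV_cong[OF DERIV_divide[OF dh's ds]])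
        (use r in \<open>auto simp: sr K_def field_simps power2_eq_square power3_eq_cube\<close>)
  qed
  define W where "W s = k s - (h r + b * (s - r\<^sup>2) + (K + e) / 2 * (s - r\<^sup>2)\<^sup>2)" for s
  define W' where "W' s = k' s - (b + (K + e) * (s - r\<^sup>2))" for s
  have dW: "(W has_real_derivative W' s) (at s)" if "\<bar>s - r\<^sup>2\<bar> < d1" for s
    unfolding W_def by (rule derivative_eq_intros dk[OF that] refl)+ (simp add: W'_def)
  have dW': "(W' has_real_derivative - e) (at (r\<^sup>2))"
    unfolding W'_def by (rule derivative_eq_intros dk' refl)+ simp
  have "W' (r\<^sup>2) = 0" using r by (simp add: W'_def k'_def b_def)
  moreover have "- e < 0" using e by simp
  ultimately obtain d2 where d2: "d2 > 0" "\<And>s. \<bar>s - r\<^sup>2\<bar> < d2 \<Longrightarrow> W s \<le> W (r\<^sup>2)"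
    using local_max_of_second_derivative_neg[OF d1 dW] dW' by blast
  have W0: "W (r\<^sup>2) = 0" by (simp add: W_def k_def r_def)
  obtain r1 where r1: "r1 > 0" "\<And>y. y \<in> ball x r1 \<Longrightarrow> u y - h (norm y) \<le> u x - h (norm x)"
    using lm by (auto simp: local_max_at_def)
  have "isCont (\<lambda>y. (norm y)\<^sup>2) x" by (intro continuous_intros)
  then have "\<forall>\<^sub>F y in at x. \<bar>(norm y)\<^sup>2 - r\<^sup>2\<bar> < d2"
    using d2(1) unfolding isCont_def r_def by (auto dest!: tendstoD simp: dist_real_def)
  then obtain r2 where r2: "r2 > 0" "\<And>y. y \<noteq> x \<Longrightarrow> dist y x < r2 \<Longrightarrow> \<bar>(norm y)\<^sup>2 - r\<^sup>2\<bar> < d2"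
    by (auto simp: eventually_at)
  have "local_max_at (\<lambda>y. u y - (h r + b * ((norm y)\<^sup>2 - (norm x)\<^sup>2) + (K + e) / 2 * ((norm y)\<^sup>2 - (norm x)\<^sup>2)\<^sup>2)) x"
    unfolding local_max_at_def
  proof (intro exI conjI ballI)
    show "0 < min r1 r2" using r1 r2 by simp
    fix y assume y: "y \<in> ball x (min r1 r2)"
    have "\<bar>(norm y)\<^sup>2 - r\<^sup>2\<bar> < d2" using r2(2)[of y] y d2 by (cases "y = x") (auto simp: r_def dist_commute)
    then have "W ((norm y)\<^sup>2) \<le> 0" using d2(2) W0 by simp
    moreover have "u y - h (norm y) \<le> u x - h r" using r1(2)[of y] y by (simp add: r_def)
    ultimately show "u y - (h r + b * ((norm y)\<^sup>2 - (norm x)\<^sup>2) + (K + e) / 2 * ((norm y)\<^sup>2 - (norm x)\<^sup>2)\<^sup>2)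
      \<le> u x - (h r + b * ((norm x)\<^sup>2 - (norm x)\<^sup>2) + (K + e) / 2 * ((norm x)\<^sup>2 - (norm x)\<^sup>2)\<^sup>2)"
      by (simp add: W_def k_def r_def)
  qed
  moreover have "0 \<le> b" using nn r by (simp add: b_def r_def)
  ultimately have "f (u x) + g (u x) * (2 * b * norm x) powr q
    \<le> (real CARD('n) - 1) * (2 * b) + max (2 * b + 4 * (K + e) * (norm x)\<^sup>2) 0"
    by (rule visc_subsol_quartic_test[OF u])
  moreover have "2 * b * norm x = h' (norm x)" "2 * b = h' (norm x) / norm x"
    using r by (simp_all add: b_def r_def)
  moreover have "2 * b + 4 * (K + e) * (norm x)\<^sup>2 = m + \<epsilon>"
    using r unfolding b_def K_def e_def r_def[symmetric]
    by (simp add: field_simps power2_eq_square power3_eq_cube)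
  ultimately show "f (u x) + g (u x) * h' (norm x) powr q
    \<le> (real CARD('n) - 1) * (h' (norm x) / norm x) + max m 0 + \<epsilon>"
    using \<epsilon> by simp
qed

text \<open>No doubling of variables is involved: the barrier \<open>h\<close> is regular enough to
  be tested directly. It equals \<open>a < u 0\<close> at the centre and exceeds \<open>u\<close> on
  the sphere of radius \<open>r1\<close>, so \<open>u - h\<close> has a positive interior maximum,
  where strict monotonicity of \<open>f\<close> and monotonicity of \<open>g\<close> yield a
  contradiction.\<close>

lemma no_visc_subsol:
  fixes f g :: "real \<Rightarrow> real" and u :: "real^'n \<Rightarrow> real"
  assumes q: "0 < q" and f: "strict_mono f" "\<And>t. 0 < f t" and g: "mono g" and \<kappa>: "0 < \<kappa>"
    and super: "\<And>\<eta>. 0 < \<eta> \<Longrightarrow> \<exists>p T. p A < \<eta> \<and> (\<forall>t\<ge>A. 0 < p t \<and> integral {A..t} (\<lambda>s. 1 / p s) \<le> T \<and>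
      (\<exists>D. (p has_real_derivative D) (at t) \<and> max (p t * D) 0 + \<kappa> * p t \<le> f t + g t * p t powr q))"
  shows "\<not> visc_subsol f g q u"
proof
  assume u: "visc_subsol f g q u"
  define N where "N = real CARD('n)"
  have N: "N \<ge> 1" by (simp add: N_def Suc_leI)
  define a where "a = min (u 0) A - 1"
  have a: "a < u 0" "a < A" by (simp_all add: a_def)
  define ga where "ga = max (- g a) 0"
  have ga: "0 \<le> ga" "- ga \<le> g a" by (simp_all add: ga_def)
  \<comment> \<open>Slopes up to \<open>\<delta>0\<close> keep the gradient term above
    \<open>- f a / 2\<close>; \<open>ga + 1\<close> avoids a division by zero.\<close>
  define \<delta>0 where "\<delta>0 = (f a / (2 * (ga + 1))) powr (1 / q)"
  have \<delta>0: "\<delta>0 > 0" using f(2)[of a] ga by (simp add: \<delta>0_def)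
  have \<delta>0q: "ga * \<delta>0 powr q \<le> f a / 2"
  proof -
    have "\<delta>0 powr q = f a / (2 * (ga + 1))"
      using q f(2)[of a] ga by (simp add: \<delta>0_def powr_powr)
    then have "ga * \<delta>0 powr q = (ga / (ga + 1)) * (f a / 2)" using ga by simp
    also have "\<dots> \<le> 1 * (f a / 2)" using ga f(2)[of a] by (intro mult_right_mono) auto
    finally show ?thesis by simp
  qed
  \<comment> \<open>\<open>N / \<kappa>\<close> makes the curvature term at most
    \<open>\<kappa> * p t\<close> outside the ball, the third entry gives
    \<open>\<delta> \<le> \<delta>0\<close>, and the fourth bounds the trace of the Hessian of the
    paraboloid by \<open>f a / 2\<close>.\<close>
  define R where "R = Max {1, N / \<kappa>, 2 * (A - a) / \<delta>0, 4 * N * (A - a) / f a}"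
  have R: "1 \<le> R" "N / \<kappa> \<le> R" "2 * (A - a) / \<delta>0 \<le> R" "4 * N * (A - a) / f a \<le> R"
    by (simp_all add: R_def)
  then have R0: "R > 0" by simp
  \<comment> \<open>The paraboloid \<open>a + \<delta> / (2 * R) * r\<^sup>2\<close> reaches
    \<open>A\<close> at \<open>r = R\<close>, where its slope is \<open>\<delta>\<close>.\<close>
  define \<delta> where "\<delta> = 2 * (A - a) / R"
  have \<delta>: "0 < \<delta>" "\<delta> \<le> \<delta>0" using a R R0 \<delta>0 by (auto simp: \<delta>_def field_simps)
  have \<delta>R: "N * (\<delta> / R) \<le> f a / 2"
  proof -
    have "2 * (N * \<delta>) \<le> f a" using R(4) f(2)[of a] R0 by (simp add: \<delta>_def field_simps)
    then have "N * \<delta> / R \<le> f a / 2 / R" using R0 by (intro divide_right_mono) auto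
    also have "\<dots> \<le> f a / 2" using R(1) f(2)[of a] by (simp add: field_simps)
    finally show ?thesis by simp
  qed
  obtain p T where pA: "p A < \<delta>" and p: "\<And>t. A \<le> t \<Longrightarrow> 0 < p t"
    and T: "\<And>t. A \<le> t \<Longrightarrow> integral {A..t} (\<lambda>s. 1 / p s) \<le> T"
    and pD: "\<And>t. A \<le> t \<Longrightarrow> \<exists>D. (p has_real_derivative D) (at t) \<and> max (p t * D) 0 + \<kappa> * p t \<le> f t + g t * p t powr q"
    using super[OF \<delta>(1)] by blast
  have pcont: "isCont p t" if "A \<le> t" for t using pD[OF that] DERIV_isCont by blast
  have usc: "usc u" using u by (simp add: visc_subsol_def)
  \<comment> \<open>The radius at which \<open>h\<close> reaches \<open>M\<close> depends on
    \<open>M\<close> but never exceeds \<open>R + max T 0\<close>. Bounding \<open>u\<close> on this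
    larger ball first avoids a circular choice of \<open>M\<close>.\<close>
  obtain xm where xm: "\<And>y. y \<in> cball 0 (R + max T 0) \<Longrightarrow> u y \<le> u xm"
    using usc_attains_max[OF usc, of "cball 0 (R + max T 0)"] R0 by (auto simp: not_less)
  define M where "M = max (u xm) A + 1"
  have M: "A < M" "u xm < M" by (simp_all add: M_def)
  \<comment> \<open>Freezing \<open>p\<close> above \<open>M\<close> as well makes the flow global,
    in spite of the finite blow-up time of the profile.\<close>
  define P where "P t = p (min (max t A) M)" for t
  have posP: "0 < P t" for t using M by (simp add: P_def p)
  have cP: "continuous_on UNIV P" unfolding P_def
    by (rule continuous_on_compose2[of "{A..}" p])
      (use pcont M in \<open>auto intro!: continuous_intros continuous_at_imp_continuous_on\<close>)
  have Pp: "P t = p t" if "A \<le> t" "t \<le> M" for t using that by (simp add: P_def max_def min_def)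
  have c1: "continuous_on S (\<lambda>s. 1 / P s)" for S
    by (intro continuous_intros continuous_on_subset[OF cP]) (use posP in \<open>auto simp: less_imp_neq[symmetric]\<close>)
  have unb: "\<exists>t\<ge>A. c \<le> integral {A..t} (\<lambda>s. 1 / P s)" for c
  proof -
    define t where "t = M + \<bar>c\<bar> * p M"
    have pM: "p M > 0" using p M by simp
    have t: "M \<le> t" using pM by (simp add: t_def)
    have "c \<le> integral {M..t} (\<lambda>s. 1 / p M)" using pM t by (simp add: t_def)
    also have "\<dots> = integral {M..t} (\<lambda>s. 1 / P s)"
      using M by (intro integral_cong) (auto simp: P_def max_def min_def)
    also have "\<dots> \<le> integral {A..M} (\<lambda>s. 1 / P s) + integral {M..t} (\<lambda>s. 1 / P s)"
      using posP by (simp add: integral_nonneg integrable_continuous_interval c1 less_imp_le)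
    also have "\<dots> = integral {A..t} (\<lambda>s. 1 / P s)"
      using M t by (intro Henstock_Kurzweil_Integration.integral_combine integrable_continuous_interval c1) auto
    finally show ?thesis using t M by (intro exI[of _ t]) auto
  qed
  obtain H where dH: "\<And>r. (H has_real_derivative P (H r)) (at r)"
    and H: "\<And>t. A \<le> t \<Longrightarrow> H (integral {A..t} (\<lambda>s. 1 / P s)) = t"
    using flow_exists[OF cP posP _ unb] M by (auto simp: P_def)
  have Hmono: "H x < H y" if "x < y" for x y
    using DERIV_pos_imp_increasing[OF that, of H] dH posP by metis
  have H0: "H 0 = A" using H[of A] by simp
  define T1 where "T1 = integral {A..M} (\<lambda>s. 1 / P s)"
  have HT1: "H T1 = M" using H M by (simp add: T1_def)
  have "T1 = integral {A..M} (\<lambda>s. 1 / p s)" unfolding T1_def by (intro integral_cong) (simp add: Pp)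
  then have T1T: "T1 \<le> T" using T M by simp
  have T1: "0 < T1"
  proof (rule ccontr)
    assume "\<not> 0 < T1"
    then have "T1 = 0 \<or> T1 < 0" by linarith
    then have "H T1 \<le> H 0" using Hmono by (auto simp: less_imp_le)
    then show False using H0 HT1 M by simp
  qed
  define r1 where "r1 = R + T1"
  define h where "h r = (if r \<le> R then a + \<delta> / (2 * R) * r\<^sup>2 else H (r - R))" for r
  have hR: "a + \<delta> / (2 * R) * R\<^sup>2 = A" using R0 by (simp add: \<delta>_def power2_eq_square field_simps)
  have ha: "a \<le> h r" if "0 \<le> r" for r
    using \<delta> R0 a Hmono[of 0 "r - R"] H0 by (auto simp: h_def)
  have "continuous_on UNIV h" unfolding h_def
  proof (rule continuous_on_cases_le[where h = "\<lambda>r. r"])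
    show "continuous_on {r \<in> UNIV. r \<le> R} (\<lambda>r. a + \<delta> / (2 * R) * r\<^sup>2)"
      by (auto intro!: continuous_intros simp only:)
    have "isCont (\<lambda>r. H (r - R)) r" for r
      by (rule isCont_o2[OF _ DERIV_isCont[OF dH]]) (intro continuous_intros)
    then show "continuous_on {r \<in> UNIV. R \<le> r} (\<lambda>r. H (r - R))"
      by (intro continuous_at_imp_continuous_on ballI)
  qed (use hR H0 in auto)
  then have "continuous_on UNIV (\<lambda>y :: real^'n. h (norm y))"
    by (rule continuous_on_compose2) (auto intro!: continuous_intros)
  then have uscw: "usc (\<lambda>y. u y - h (norm y))" by (rule usc_diff_continuous[OF usc])
  obtain x where x: "x \<in> cball 0 r1" and xmax: "\<And>y. y \<in> cball 0 r1 \<Longrightarrow> u y - h (norm y) \<le> u x - h (norm x)"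
    using usc_attains_max[OF uscw, of "cball 0 r1"] R0 T1 by (auto simp: r1_def not_less)
  have "0 < u 0 - h (norm (0 :: real^'n))" using a R0 by (simp add: h_def)
  also have "\<dots> \<le> u x - h (norm x)" using R0 T1 by (intro xmax) (simp add: r1_def)
  finally have uh: "h (norm x) < u x" by simp
  have xr1: "norm x < r1"
  proof (rule ccontr)
    assume "\<not> norm x < r1"
    then have "norm x = r1" using x by simp
    then have "h (norm x) = M" using HT1 T1 by (simp add: h_def r1_def)
    moreover have "u x \<le> u xm" using x T1T by (intro xm) (simp add: r1_def)
    ultimately show False using M uh by simp
  qed
  have lm: "local_max_at (\<lambda>y. u y - h (norm y)) x"
    unfolding local_max_at_def
  proof (intro exI conjI ballI)
    show "0 < r1 - norm x" using xr1 by simp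
    fix y assume "y \<in> ball x (r1 - norm x)"
    then have "norm y \<le> r1" using norm_triangle_ineq[of x "y - x"] by (simp add: dist_norm norm_minus_commute)
    then show "u y - h (norm y) \<le> u x - h (norm x)" by (intro xmax) simp
  qed
  show False
  proof (cases "norm x \<le> R")
    case True
    define b where "b = \<delta> / (2 * R)"
    have b: "b > 0" using \<delta> R0 by (simp add: b_def)
    \<comment> \<open>Just outside radius \<open>R\<close> the profile has slope near
      \<open>p A < \<delta>\<close>, so \<open>h\<close> stays below the continued paraboloid, which
      can then be used as test function even when \<open>norm x = R\<close>.\<close>
    have "((\<lambda>r. H (r - R) - (a + b * r\<^sup>2)) has_real_derivative P (H (R - R)) * 1 - b * (2 * R)) (at R)"
      by (rule DERIV_cong[OF DERIV_diff[OF DERIV_chain2[OF dH]]]) (auto intro!: derivative_eq_intros)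
    moreover have "P (H (R - R)) * 1 - b * (2 * R) < 0" using pA H0 Pp M R0 by (simp add: b_def)
    ultimately obtain d where d: "d > 0" "\<And>h. 0 < h \<Longrightarrow> h < d \<Longrightarrow>
        H (R + h - R) - (a + b * (R + h)\<^sup>2) < H (R - R) - (a + b * R\<^sup>2)"
      using DERIV_neg_dec_right by blast
    have hle: "h r \<le> a + b * r\<^sup>2" if "r < R + d" for r
      using d(2)[of "r - R"] that H0 hR by (auto simp: h_def b_def)
    obtain r where r: "r > 0" "\<And>y. y \<in> ball x r \<Longrightarrow> u y - h (norm y) \<le> u x - h (norm x)"
      using lm by (auto simp: local_max_at_def)
    have "local_max_at (\<lambda>y. u y - (h (norm x) + b * ((norm y)\<^sup>2 - (norm x)\<^sup>2) + 0 / 2 * ((norm y)\<^sup>2 - (norm x)\<^sup>2)\<^sup>2)) x"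
      unfolding local_max_at_def
    proof (intro exI conjI ballI)
      show "0 < min r d" using r d by simp
      fix y assume y: "y \<in> ball x (min r d)"
      have "norm y < R + d" using y True norm_triangle_ineq[of x "y - x"] by (simp add: dist_norm norm_minus_commute)
      then have "h (norm y) \<le> a + b * (norm y)\<^sup>2" by (rule hle)
      moreover have "h (norm x) = a + b * (norm x)\<^sup>2" using True by (simp add: h_def b_def)
      ultimately show "u y - (h (norm x) + b * ((norm y)\<^sup>2 - (norm x)\<^sup>2) + 0 / 2 * ((norm y)\<^sup>2 - (norm x)\<^sup>2)\<^sup>2)
        \<le> u x - (h (norm x) + b * ((norm x)\<^sup>2 - (norm x)\<^sup>2) + 0 / 2 * ((norm x)\<^sup>2 - (norm x)\<^sup>2)\<^sup>2)"
        using r(2)[of y] y by (simp add: algebra_simps)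
    qed
    then have "f (u x) + g (u x) * (2 * b * norm x) powr q \<le> (N - 1) * (2 * b) + max (2 * b + 4 * 0 * (norm x)\<^sup>2) 0"
      unfolding N_def by (rule visc_subsol_quartic_test[OF u]) (use b in simp)
    also have "\<dots> = N * (2 * b)" using b by (simp add: algebra_simps)
    also have "\<dots> = N * (\<delta> / R)" by (simp add: b_def)
    also note \<delta>R
    finally have 1: "f (u x) + g (u x) * (2 * b * norm x) powr q \<le> f a / 2" .
    have au: "a < u x" using uh ha[of "norm x"] by simp
    then have "f a < f (u x)" using f(1) by (simp add: strict_mono_less)
    have "2 * b * norm x \<le> 2 * b * R" using True b by simp
    also have "\<dots> = \<delta>" using R0 by (simp add: b_def)
    finally have pw: "(2 * b * norm x) powr q \<le> \<delta>0 powr q" using \<delta> q b by (intro powr_mono2) auto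
    have "- (f a / 2) \<le> - (ga * (2 * b * norm x) powr q)"
      using mult_left_mono[OF pw ga(1)] \<delta>0q by simp
    also have "\<dots> \<le> g (u x) * (2 * b * norm x) powr q"
    proof -
      have "- ga \<le> g (u x)" using ga(2) monoD[OF g, of a "u x"] au by simp
      from mult_right_mono[OF this, of "(2 * b * norm x) powr q"] show ?thesis by simp
    qed
    finally show False using 1 \<open>f a < f (u x)\<close> by simp
  next
    case False
    define t where "t = H (norm x - R)"
    have ht: "h (norm x) = t" using False by (simp add: h_def t_def)
    have t: "A < t" "t < M" using Hmono[of 0 "norm x - R"] Hmono[of "norm x - R" T1] False xr1 H0 HT1
      by (auto simp: t_def r1_def)
    obtain D where D: "(p has_real_derivative D) (at t)" "max (p t * D) 0 + \<kappa> * p t \<le> f t + g t * p t powr q"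
      using pD t by (meson less_imp_le)
    have DP: "(P has_real_derivative D) (at t)"
      by (rule has_field_derivative_transform_within_open[OF D(1), of "{A<..<M}"]) (use t Pp in auto)
    have dh: "(h has_real_derivative P (H (r - R))) (at r)" if "\<bar>r - norm x\<bar> < norm x - R" for r
    proof -
      have "((\<lambda>r. H (r - R)) has_real_derivative P (H (r - R)) * 1) (at r)"
        by (rule DERIV_chain2[OF dH]) (auto intro!: derivative_eq_intros)
      then have "(h has_real_derivative P (H (r - R)) * 1) (at r)"
        by (rule has_field_derivative_transform_within_open[of _ _ _ "{R<..}"]) (use that in \<open>auto simp: h_def\<close>)
      then show ?thesis by simp
    qed
    have "((\<lambda>r. H (r - R)) has_real_derivative P t * 1) (at (norm x))"
      unfolding t_def by (rule DERIV_chain2[OF dH]) (auto intro!: derivative_eq_intros)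
    then have dh': "((\<lambda>r. P (H (r - R))) has_real_derivative D * (P t * 1)) (at (norm x))"
      by (rule DERIV_chain2[of P D "\<lambda>r. H (r - R)", rotated]) (use DP in \<open>simp add: t_def\<close>)
    have xR: "0 < norm x" using False R0 by linarith
    then have x0: "x \<noteq> 0" by auto
    have "f (u x) + g (u x) * P (H (norm x - R)) powr q \<le>
        (real CARD('n) - 1) * (P (H (norm x - R)) / norm x) + max (D * (P t * 1)) 0"
      by (rule visc_subsol_radial_test[OF u lm _ _ dh dh']) (use False x0 posP in \<open>auto simp: less_imp_le\<close>)
    then have 1: "f (u x) + g (u x) * p t powr q \<le> (N - 1) * (p t / norm x) + max (p t * D) 0"
      using Pp t by (simp add: t_def[symmetric] N_def mult.commute)
    have "N / \<kappa> \<le> norm x" using R(2) False by simp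
    then have "N / norm x \<le> \<kappa>" using \<kappa> xR by (simp add: field_simps)
    then have "(N - 1) / norm x \<le> \<kappa>"
      using divide_right_mono[of "N - 1" N "norm x"] by simp
    then have "(N - 1) * (p t / norm x) \<le> \<kappa> * p t" using mult_right_mono[of "(N - 1) / norm x" \<kappa> "p t"] p[of t] t by simp
    then have 2: "f (u x) + g (u x) * p t powr q \<le> f t + g t * p t powr q" using 1 D(2) by simp
    have "t < u x" using uh ht by simp
    then have "f t < f (u x)" "g t \<le> g (u x)" using f(1) monoD[OF g] by (auto simp: strict_mono_less)
    moreover from this have "g t * p t powr q \<le> g (u x) * p t powr q" by (intro mult_right_mono) auto
    ultimately show False using 2 by simp
  qed
qed

section \<open>Convergence of the integrals\<close>

lemma nn_integral_Icc_continuous: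
  fixes \<phi> :: "real \<Rightarrow> real"
  assumes "continuous_on {a..b} \<phi>" "\<And>t. a \<le> t \<Longrightarrow> t \<le> b \<Longrightarrow> 0 \<le> \<phi> t"
  shows "(\<integral>\<^sup>+t\<in>{a..b}. ennreal (\<phi> t) \<partial>lborel) = ennreal (integral {a..b} \<phi>)"
  by (rule nn_integral_has_integral_lebesgue')
    (use assms in \<open>auto intro!: integrable_integral integrable_continuous_interval\<close>)

lemma nn_integral_atLeast_le:
  fixes \<phi> :: "real \<Rightarrow> real"
  assumes cont: "continuous_on {A..} \<phi>" and nn: "\<And>t. A \<le> t \<Longrightarrow> 0 \<le> \<phi> t"
    and le: "\<And>t. A \<le> t \<Longrightarrow> integral {A..t} \<phi> \<le> c"
  shows "(\<integral>\<^sup>+t\<in>{A..}. ennreal (\<phi> t) \<partial>lborel) \<le> ennreal c"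
proof -
  let ?F = "\<lambda>n t. ennreal (\<phi> t) * indicator {A..A + real n} t"
  have c: "continuous_on {A..t} \<phi>" for t by (rule continuous_on_subset[OF cont]) auto
  have sup: "ennreal (\<phi> t) * indicator {A..} t = (SUP n. ?F n t)" for t
  proof (rule antisym)
    obtain n where "t - A \<le> real n" using real_arch_simple by blast
    then show "ennreal (\<phi> t) * indicator {A..} t \<le> (SUP n. ?F n t)"
      by (intro SUP_upper2[of n]) (auto simp: indicator_def)
    show "(SUP n. ?F n t) \<le> ennreal (\<phi> t) * indicator {A..} t"
      by (intro SUP_least) (auto simp: indicator_def)
  qed
  have meas: "?F n \<in> borel_measurable lborel" for n
  proof -
    have "(\<lambda>t. indicator {A..A + real n} t *\<^sub>R \<phi> t) \<in> borel_measurable borel"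
      by (intro borel_measurable_continuous_on_indicator c) auto
    then have "(\<lambda>t. ennreal (indicator {A..A + real n} t *\<^sub>R \<phi> t)) \<in> borel_measurable lborel" by simp
    also have "(\<lambda>t. ennreal (indicator {A..A + real n} t *\<^sub>R \<phi> t)) = ?F n"
      by (auto simp: fun_eq_iff indicator_def)
    finally show ?thesis .
  qed
  have "(\<integral>\<^sup>+t\<in>{A..}. ennreal (\<phi> t) \<partial>lborel) = (SUP n. integral\<^sup>N lborel (?F n))"
    unfolding sup
    by (rule nn_integral_monotone_convergence_SUP[OF _ meas])
      (auto simp: incseq_def le_fun_def indicator_def)
  also have "\<dots> \<le> ennreal c"
  proof (rule SUP_least)
    fix n
    have "integral\<^sup>N lborel (?F n) = ennreal (integral {A..A + real n} \<phi>)"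
      by (rule nn_integral_Icc_continuous[OF c]) (use nn in auto)
    also have "\<dots> \<le> ennreal c" by (intro ennreal_leI le) simp
    finally show "integral\<^sup>N lborel (?F n) \<le> ennreal c" .
  qed
  finally show ?thesis .
qed

text \<open>Links the integrals over \<open>{0..}\<close> in the theorem with the integral of
  \<open>1 / p\<close> that governs the flow. The integrands have at worst a singularity
  \<open>t powr (- 1 / 2)\<close> at 0, so divergence comes from the tail. Since
  \<open>0 powr (- 1 / 2) = 0\<close>, the \<open>+ 1\<close> leaves room for the value at 0 and for
  a bounded summand.\<close>

lemma integral_unbounded_of_nn_integral_infinite:
  fixes h p :: "real \<Rightarrow> real"
  assumes inf: "(\<integral>\<^sup>+t\<in>{0..}. ennreal (h t) \<partial>lborel) = \<infinity>"
    and near: "\<And>t. 0 \<le> t \<Longrightarrow> t \<le> A \<Longrightarrow> h t \<le> C * (t powr (- 1 / 2) + 1)"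
    and cont: "continuous_on {A..} p" and pos: "\<And>t. A \<le> t \<Longrightarrow> 0 < p t"
    and le: "\<And>t. A \<le> t \<Longrightarrow> h t \<le> K * (1 / p t)" and K: "0 < K" and A: "0 \<le> A" and C: "0 \<le> C"
  shows "\<exists>t\<ge>A. c \<le> integral {A..t} (\<lambda>s. 1 / p s)"
proof (rule ccontr)
  assume "\<not> ?thesis"
  then have bd: "integral {A..t} (\<lambda>s. 1 / p s) \<le> c" if "A \<le> t" for t using that by force
  have cK: "continuous_on {A..} (\<lambda>t. K * (1 / p t))"
    by (intro continuous_intros cont) (use pos in force)
  have "integral {A..t} (\<lambda>t. K * (1 / p t)) \<le> K * c" if "A \<le> t" for t
    unfolding Henstock_Kurzweil_Integration.integral_mult_right
    using bd[OF that] K by (intro mult_left_mono) auto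
  then have far: "(\<integral>\<^sup>+t\<in>{A..}. ennreal (K * (1 / p t)) \<partial>lborel) \<le> ennreal (K * c)"
    by (intro nn_integral_atLeast_le cK) (use pos K in \<open>auto simp: less_imp_le\<close>)
  have "(\<lambda>t. t powr (- 1 / 2)) integrable_on {0..A}"
    using integrable_on_powr_from_0[of "- 1 / 2" A] A by simp
  then have "(\<lambda>t. C * (t powr (- 1 / 2) + 1)) integrable_on {0..A}"
    by (intro integrable_on_mult_right integrable_add) auto
  then obtain I where "((\<lambda>t. C * (t powr (- 1 / 2) + 1)) has_integral I) {0..A}" by blast
  then have nr: "(\<integral>\<^sup>+t\<in>{0..A}. ennreal (C * (t powr (- 1 / 2) + 1)) \<partial>lborel) = ennreal I"
    by (intro nn_integral_has_integral_lebesgue') (use C in auto)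
  let ?N = "\<lambda>t. ennreal (C * (t powr (- 1 / 2) + 1)) * indicator {0..A} t"
  let ?G = "\<lambda>t. ennreal (K * (1 / p t)) * indicator {A..} t"
  have "(\<integral>\<^sup>+t\<in>{0..}. ennreal (h t) \<partial>lborel) \<le> (\<integral>\<^sup>+t. ?N t + ?G t \<partial>lborel)"
  proof (intro nn_integral_mono)
    fix t
    consider "t < 0" | "0 \<le> t" "t \<le> A" | "A < t" by linarith
    then show "ennreal (h t) * indicator {0..} t \<le> ?N t + ?G t"
    proof cases
      case 2
      then have "ennreal (h t) * indicator {0..} t \<le> ?N t" using near by (auto intro: ennreal_leI)
      also have "\<dots> \<le> ?N t + ?G t" by simp
      finally show ?thesis .
    next
      case 3
      then have "ennreal (h t) * indicator {0..} t \<le> ?G t" using le[of t] A by (auto intro: ennreal_leI)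
      then show ?thesis using 3 by simp
    qed auto
  qed
  also have "\<dots> = (\<integral>\<^sup>+t. ?N t \<partial>lborel) + (\<integral>\<^sup>+t. ?G t \<partial>lborel)"
  proof (rule nn_integral_add)
    have "(\<lambda>t. indicator {A..} t *\<^sub>R (K * (1 / p t))) \<in> borel_measurable borel"
      by (intro borel_measurable_continuous_on_indicator cK) auto
    then have "(\<lambda>t. ennreal (indicator {A..} t *\<^sub>R (K * (1 / p t)))) \<in> borel_measurable lborel" by simp
    also have "(\<lambda>t. ennreal (indicator {A..} t *\<^sub>R (K * (1 / p t)))) = ?G"
      by (auto simp: fun_eq_iff indicator_def)
    finally show "?G \<in> borel_measurable lborel" .
  qed measurable
  also have "\<dots> < \<infinity>" using nr far by (simp add: order_le_less_trans)
  finally show False using inf by simp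
qed

lemma integral_bounded_of_nn_integral_finite:
  fixes h p :: "real \<Rightarrow> real"
  assumes fin: "(\<integral>\<^sup>+t\<in>{0..}. ennreal (h t) \<partial>lborel) \<noteq> \<infinity>"
    and cont: "continuous_on {A..} p" and pos: "\<And>t. A \<le> t \<Longrightarrow> 0 < p t"
    and le: "\<And>t. A \<le> t \<Longrightarrow> 1 / p t \<le> K * h t" and K: "0 < K" and A: "0 \<le> A"
  shows "\<exists>T. \<forall>t\<ge>A. integral {A..t} (\<lambda>s. 1 / p s) \<le> T"
proof -
  obtain T where T: "0 \<le> T" "(\<integral>\<^sup>+t\<in>{0..}. ennreal (h t) \<partial>lborel) = ennreal T"
    using fin by (metis ennreal_cases infinity_ennreal_def)
  have "integral {A..t} (\<lambda>s. 1 / p s) \<le> K * T" if "A \<le> t" for t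
  proof -
    have c: "continuous_on {A..t} (\<lambda>s. 1 / K * (1 / p s))"
      by (intro continuous_intros continuous_on_subset[OF cont]) (use pos in force)+
    have "ennreal (integral {A..t} (\<lambda>s. 1 / K * (1 / p s))) = (\<integral>\<^sup>+s\<in>{A..t}. ennreal (1 / K * (1 / p s)) \<partial>lborel)"
      by (rule nn_integral_Icc_continuous[symmetric, OF c]) (use pos K in \<open>auto simp: less_imp_le\<close>)
    also have "\<dots> \<le> (\<integral>\<^sup>+t\<in>{0..}. ennreal (h t) \<partial>lborel)"
    proof (intro nn_integral_mono)
      fix s
      have "1 / K * (1 / p s) \<le> h s" if "A \<le> s"
        using mult_left_mono[OF le[OF that], of "1 / K"] K by simp
      then show "ennreal (1 / K * (1 / p s)) * indicator {A..t} s \<le> ennreal (h s) * indicator {0..} s"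
        using A by (auto simp: indicator_def intro!: ennreal_leI)
    qed
    finally have "integral {A..t} (\<lambda>s. 1 / K * (1 / p s)) \<le> T" using T by (simp only: ennreal_le_iff)
    then have "1 / K * integral {A..t} (\<lambda>s. 1 / p s) \<le> T"
      by (simp only: Henstock_Kurzweil_Integration.integral_mult_right)
    then show ?thesis using K by (simp add: field_simps)
  qed
  then show ?thesis by blast
qed

text \<open>The lower bounds for \<open>w\<close>, \<open>F\<close> and \<open>G\<close> involve the
  data at \<open>t / 2\<close>; the substitution costs only a factor 2.\<close>

lemma nn_integral_rescale_finite:
  fixes h :: "real \<Rightarrow> real"
  assumes fin: "(\<integral>\<^sup>+t\<in>{0..}. ennreal (h t) \<partial>lborel) \<noteq> \<infinity>" and [measurable]: "h \<in> borel_measurable borel"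
  shows "(\<integral>\<^sup>+t\<in>{0..}. ennreal (h (t / 2)) \<partial>lborel) \<noteq> \<infinity>"
proof -
  have "(\<integral>\<^sup>+t\<in>{0..}. ennreal (h t) \<partial>lborel) =
      ennreal \<bar>1 / 2\<bar> * (\<integral>\<^sup>+t. ennreal (h (0 + 1 / 2 * t)) * indicator {0..} (0 + 1 / 2 * t) \<partial>lborel)"
    by (rule nn_integral_real_affine) auto
  also have "(\<integral>\<^sup>+t. ennreal (h (0 + 1 / 2 * t)) * indicator {0..} (0 + 1 / 2 * t) \<partial>lborel) =
      (\<integral>\<^sup>+t\<in>{0..}. ennreal (h (t / 2)) \<partial>lborel)"
    by (intro nn_integral_cong) (auto simp: indicator_def)
  finally have "ennreal (1 / 2) * (\<integral>\<^sup>+t\<in>{0..}. ennreal (h (t / 2)) \<partial>lborel) \<noteq> \<infinity>" using fin by simp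
  then show ?thesis by (auto simp: ennreal_mult_eq_top_iff)
qed

text \<open>As \<open>1 / p\<close> is nonincreasing, \<open>(t - A) / p t\<close> is at most the
  integral. This linear growth lets the curvature term be absorbed in the nonexistence proofs
  below.\<close>

lemma linear_bound_of_integral_bounded:
  fixes p :: "real \<Rightarrow> real"
  assumes cont: "continuous_on {A..} p" and pos: "\<And>t. A \<le> t \<Longrightarrow> 0 < p t"
    and mono: "\<And>s t. A \<le> s \<Longrightarrow> s \<le> t \<Longrightarrow> p s \<le> p t"
    and T: "\<And>t. A \<le> t \<Longrightarrow> integral {A..t} (\<lambda>s. 1 / p s) \<le> T" and A: "0 < A"
  obtains B where "0 < B" "\<And>t. A \<le> t \<Longrightarrow> t \<le> B * p t"
proof
  have "0 \<le> T" using T[of A] by simp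
  then show "0 < A / p A + T" using A pos[of A] by (simp add: add_pos_nonneg)
  fix t assume t: "A \<le> t"
  have "(t - A) * (1 / p t) = integral {A..t} (\<lambda>s. 1 / p t)" using t by simp
  also have "\<dots> \<le> integral {A..t} (\<lambda>s. 1 / p s)"
  proof (rule integral_le)
    show "(\<lambda>s. 1 / p s) integrable_on {A..t}"
      by (intro integrable_continuous_interval continuous_intros continuous_on_subset[OF cont]) (use pos in force)+
    show "1 / p t \<le> 1 / p s" if "s \<in> {A..t}" for s
      using that mono[of s t] pos[of s] by (simp add: frac_le)
  qed auto
  also have "\<dots> \<le> T" by (rule T[OF t])
  finally have "t - A \<le> T * p t" using pos[OF t] by (simp add: field_simps)
  moreover have "A \<le> A / p A * p t" using mono[of A t] t A pos[of A] by (simp add: field_simps)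
  ultimately show "t \<le> (A / p A + T) * p t" by (simp add: algebra_simps)
qed

section \<open>Nonpositive gradient terms\<close>

lemma has_real_derivative_integral:
  fixes \<phi> :: "real \<Rightarrow> real"
  assumes "continuous_on UNIV \<phi>" "a < t"
  shows "((\<lambda>x. integral {a..x} \<phi>) has_real_derivative \<phi> t) (at t)"
proof -
  have "((\<lambda>x. integral {a..x} \<phi>) has_real_derivative \<phi> t) (at t within {a..t + 1})"
    by (rule integral_has_real_derivative) (use assms continuous_on_subset in auto)
  then show ?thesis using assms by (simp add: at_within_Icc_at)
qed

lemma continuous_on_max_0:
  fixes \<phi> :: "'a :: topological_space \<Rightarrow> real"
  assumes "continuous_on S \<phi>"
  shows "continuous_on S (\<lambda>x. max (\<phi> x) 0)"
  by (intro continuous_intros assms)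

lemma inverse_sqrt_powr:
  assumes "0 < t"
  shows "1 / sqrt t = t powr (- 1 / 2)"
  using assms by (simp add: powr_half_sqrt[symmetric] powr_minus_divide)

locale nonpos_gradient_term =
  fixes f g :: "real \<Rightarrow> real" and q :: real
  assumes q: "0 < q"
    and f_cont: "continuous_on UNIV f" and g_cont: "continuous_on UNIV g"
    and f_mono: "strict_mono f" and g_mono: "mono g"
    and f_pos: "0 < f t" and g_nonpos: "g t \<le> 0"
begin

text \<open>Normalised so that \<open>f t + g t * p powr q = f t * (1 - (b t * p\<^sup>2) powr (q /
  2))\<close> for \<open>p > 0\<close>; where \<open>b t > 0\<close>, the right-hand side vanishes
  at the slope \<open>1 / sqrt (b t)\<close>.\<close>

definition b :: "real \<Rightarrow> real" where
  "b t = (max (- g t) 0 / f t) powr (2 / q)"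

text \<open>
  The equation for \<open>p\<^sup>2\<close> is \<open>(p\<^sup>2)' = 2 f (1 - (b p\<^sup>2) powr (q/2))\<close>. Since \<open>b w \<le> 1/2\<close>, the solution of the
  linear equation \<open>w' = f (1 - 2 b w)\<close> is comparable with it: \<open>4 w\<close> and \<open>\<epsilon> w\<close> serve as \<open>p\<^sup>2\<close>.
\<close>
definition w :: "real \<Rightarrow> real" where
  "w t = integral {0..t} (\<lambda>s. exp (- 2 * integral {s..t} (\<lambda>\<tau>. b \<tau> * f \<tau>)) * f s)"

definition E :: "real \<Rightarrow> real" where
  "E t = integral {0..t} (\<lambda>\<tau>. b \<tau> * f \<tau>)"

lemma f_le: "s \<le> t \<Longrightarrow> f s \<le> f t"
  using f_mono by (simp add: strict_mono_less_eq)

lemma b_nonneg: "0 \<le> b t" by (simp add: b_def)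

lemma b_antimono: "s \<le> t \<Longrightarrow> b t \<le> b s"
  unfolding b_def
  by (intro powr_mono2 frac_le) (use q f_pos f_le monoD[OF g_mono] g_nonpos in \<open>auto simp: less_imp_le divide_nonpos_pos\<close>)

lemma b_cont: "continuous_on UNIV b"
  unfolding b_def
  by (intro continuous_on_powr' continuous_on_max_0 continuous_intros f_cont g_cont)
    (use f_pos q in \<open>auto simp: less_imp_neq[symmetric] less_imp_le\<close>)

lemma bf_cont: "continuous_on S (\<lambda>t. b t * f t)"
  by (rule continuous_on_subset[of UNIV]) (auto intro!: continuous_intros b_cont f_cont)

lemma g_eq: "0 < p \<Longrightarrow> g t * p powr q = - (f t * (b t * p\<^sup>2) powr (q / 2))"
proof -
  assume p: "0 < p"
  have "(b t * p\<^sup>2) powr (q / 2) = b t powr (q / 2) * (p powr 2) powr (q / 2)"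
    using p b_nonneg by (simp add: powr_mult)
  also have "\<dots> = b t powr (q / 2) * p powr q" by (simp add: powr_powr)
  also have "b t powr (q / 2) = - g t / f t"
    using q g_nonpos[of t] f_pos[of t] by (simp add: b_def powr_powr)
  finally show ?thesis using f_pos[of t] by simp
qed

lemma E_diff: "0 \<le> s \<Longrightarrow> s \<le> t \<Longrightarrow> integral {s..t} (\<lambda>\<tau>. b \<tau> * f \<tau>) = E t - E s"
  unfolding E_def
  using Henstock_Kurzweil_Integration.integral_combine[of 0 s t "\<lambda>\<tau>. b \<tau> * f \<tau>"]
  by (simp add: integrable_continuous_interval bf_cont)

lemma E_deriv: "0 < t \<Longrightarrow> (E has_real_derivative b t * f t) (at t)"
  unfolding E_def by (intro has_real_derivative_integral bf_cont)

lemma E_deriv': "0 \<le> t \<Longrightarrow> (E has_real_derivative b t * f t) (at t within {0..})"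
proof -
  assume t: "0 \<le> t"
  have "(E has_real_derivative b t * f t) (at t within {0..t+1})"
    unfolding E_def by (rule integral_has_real_derivative) (use t bf_cont in auto)
  moreover have "at t within {0..t+1} = at t within {0..}"
    by (rule at_within_nhd[of t "{..<t+1}"]) auto
  ultimately show ?thesis by simp
qed

lemma E_cont: "continuous_on {0..} E"
  using E_deriv' by (meson DERIV_continuous continuous_on_eq_continuous_within atLeast_iff)

lemma E_mono: "0 \<le> s \<Longrightarrow> s \<le> t \<Longrightarrow> E s \<le> E t"
  using E_diff[of s t] integral_nonneg[of "\<lambda>\<tau>. b \<tau> * f \<tau>" "{s..t}"] b_nonneg f_pos bf_cont
  by (force simp: integrable_continuous_interval less_imp_le)

text \<open>\<open>exp (2 * E t)\<close> is the integrating factor of the linear equation, and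
  \<open>J t\<close> is \<open>w t\<close> multiplied by it. The factorisation removes
  \<open>t\<close> from the integrand, so that \<open>w\<close> can be differentiated.\<close>

definition J :: "real \<Rightarrow> real" where
  "J t = integral {0..t} (\<lambda>s. exp (2 * E s) * f s)"

lemma J_cont_integrand: "S \<subseteq> {0..} \<Longrightarrow> continuous_on S (\<lambda>s. exp (2 * E s) * f s)"
  by (intro continuous_intros continuous_on_subset[OF E_cont] continuous_on_subset[OF f_cont]) auto

lemma w_eq: "0 \<le> t \<Longrightarrow> w t = exp (- 2 * E t) * J t"
proof -
  have "w t = integral {0..t} (\<lambda>s. exp (- 2 * E t) * (exp (2 * E s) * f s))"
    unfolding w_def
  proof (intro integral_cong)
    fix s assume "s \<in> {0..t}"
    then have "integral {s..t} (\<lambda>\<tau>. b \<tau> * f \<tau>) = E t - E s" by (simp add: E_diff)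
    then show "exp (- 2 * integral {s..t} (\<lambda>\<tau>. b \<tau> * f \<tau>)) * f s = exp (- 2 * E t) * (exp (2 * E s) * f s)"
      by (simp only:) (simp add: right_diff_distrib exp_diff exp_minus field_simps)
  qed
  then show ?thesis
    by (simp only: J_def Henstock_Kurzweil_Integration.integral_mult_right)
qed

lemma w_deriv:
  assumes t: "0 < t"
  shows "(w has_real_derivative f t * (1 - 2 * (b t * w t))) (at t)"
proof -
  have "(J has_real_derivative exp (2 * E t) * f t) (at t within {0..t + 1})"
    unfolding J_def by (rule integral_has_real_derivative) (use t J_cont_integrand in auto)
  then have J: "(J has_real_derivative exp (2 * E t) * f t) (at t)"
    using t by (simp add: at_within_Icc_at)
  have "((\<lambda>t. exp (- 2 * E t) * J t) has_real_derivative
      exp (- 2 * E t) * (- 2 * (b t * f t)) * J t + exp (2 * E t) * f t * exp (- 2 * E t)) (at t)"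
    by (rule derivative_eq_intros J E_deriv[OF t] refl)+ simp
  also have "exp (- 2 * E t) * (- 2 * (b t * f t)) * J t + exp (2 * E t) * f t * exp (- 2 * E t)
      = f t * (1 - 2 * (b t * w t))"
    using w_eq[of t] t by (simp add: algebra_simps mult_exp_exp)
  finally show ?thesis
    by (rule has_field_derivative_transform_within_open[of _ _ _ "{0<..}"]) (use t w_eq in auto)
qed

lemma w_le: "0 \<le> t \<Longrightarrow> w t \<le> t * f t"
proof -
  assume t: "0 \<le> t"
  have "J t \<le> integral {0..t} (\<lambda>s. exp (2 * E t) * f t)"
    unfolding J_def
    by (intro integral_le integrable_continuous_interval J_cont_integrand mult_mono)
      (use t f_pos f_le E_mono in \<open>auto simp: less_imp_le\<close>)
  also have "\<dots> = exp (2 * E t) * (t * f t)" using t by simp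
  finally have "exp (- 2 * E t) * J t \<le> exp (- 2 * E t) * (exp (2 * E t) * (t * f t))"
    by (intro mult_left_mono) auto
  also have "\<dots> = t * f t" by (simp add: mult_exp_exp flip: mult.assoc)
  finally show ?thesis using w_eq t by simp
qed

text \<open>Only the part of the integral over \<open>{s..t}\<close> is kept. The choice
  \<open>s = 0\<close> controls \<open>w\<close> near 0; \<open>s\<close> close to \<open>t\<close>
  serves the case of a negative limit.\<close>

lemma w_lower:
  assumes t: "0 \<le> s" "s \<le> t"
  shows "(t - s) * exp (- 2 * (E t - E s)) * f s \<le> w t"
proof -
  have i: "(\<lambda>r. exp (2 * E r) * f r) integrable_on {x..y}" if "0 \<le> x" for x y
    by (intro integrable_continuous_interval J_cont_integrand) (use that in auto)
  have "(t - s) * (exp (2 * E s) * f s) = integral {s..t} (\<lambda>r. exp (2 * E s) * f s)" using t by simp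
  also have "\<dots> \<le> integral {s..t} (\<lambda>r. exp (2 * E r) * f r)"
    by (intro integral_le i mult_mono) (use t f_pos f_le E_mono in \<open>auto simp: less_imp_le\<close>)
  also have "\<dots> \<le> integral {0..s} (\<lambda>r. exp (2 * E r) * f r) + integral {s..t} (\<lambda>r. exp (2 * E r) * f r)"
    using f_pos by (simp add: integral_nonneg i less_imp_le)
  also have "\<dots> = J t" unfolding J_def
    by (intro Henstock_Kurzweil_Integration.integral_combine i) (use t in auto)
  finally have "exp (- 2 * E t) * ((t - s) * (exp (2 * E s) * f s)) \<le> w t"
    using w_eq[of t] t by (simp add: mult_left_mono)
  then show ?thesis by (simp add: right_diff_distrib exp_diff exp_minus field_simps)
qed

lemma w_pos: "0 < t \<Longrightarrow> 0 < w t"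
  using w_lower[of 0 t] f_pos[of 0] by (simp add: less_le_trans[rotated])

text \<open>\<open>b\<close> is nonincreasing, so \<open>2 * b t * J t\<close> is at most the
  integral of \<open>2 * b * f * exp (2 * E)\<close>, an exact derivative whose integral is
  \<open>exp (2 * E t) - 1\<close>. In the linear equation this says that \<open>w\<close> is
  nondecreasing.\<close>

lemma bw_le: "0 \<le> t \<Longrightarrow> b t * w t \<le> 1 / 2"
proof -
  assume t: "0 \<le> t"
  have "((\<lambda>s. exp (2 * E s)) has_vector_derivative exp (2 * E s) * (2 * (b s * f s))) (at s within {0..t})" if "s \<in> {0..t}" for s
  proof -
    have "(E has_real_derivative b s * f s) (at s within {0..t})"
      by (rule DERIV_subset[OF E_deriv']) (use that in auto)
    then show ?thesis
      unfolding has_real_derivative_iff_has_vector_derivative[symmetric]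
      by (auto intro!: derivative_eq_intros)
  qed
  then have "((\<lambda>s. exp (2 * E s) * (2 * (b s * f s))) has_integral exp (2 * E t) - exp (2 * E 0)) {0..t}"
    by (intro fundamental_theorem_of_calculus t) auto
  then have 1: "integral {0..t} (\<lambda>s. exp (2 * E s) * (2 * (b s * f s))) = exp (2 * E t) - exp (2 * E 0)"
    and 2: "(\<lambda>s. exp (2 * E s) * (2 * (b s * f s))) integrable_on {0..t}"
    by (auto simp: integral_unique has_integral_integrable)
  have "2 * b t * J t = integral {0..t} (\<lambda>s. 2 * b t * (exp (2 * E s) * f s))"
    by (simp only: J_def Henstock_Kurzweil_Integration.integral_mult_right)
  also have "\<dots> \<le> integral {0..t} (\<lambda>s. exp (2 * E s) * (2 * (b s * f s)))"
  proof (intro integral_le 2)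
    show "(\<lambda>s. 2 * b t * (exp (2 * E s) * f s)) integrable_on {0..t}"
      by (intro integrable_on_mult_right integrable_continuous_interval J_cont_integrand) auto
    fix s assume "s \<in> {0..t}"
    then have "b t * (2 * (exp (2 * E s) * f s)) \<le> b s * (2 * (exp (2 * E s) * f s))"
      using b_antimono f_pos by (intro mult_right_mono) (auto simp: less_imp_le)
    then show "2 * b t * (exp (2 * E s) * f s) \<le> exp (2 * E s) * (2 * (b s * f s))"
      by (simp add: mult_ac)
  qed
  also have "\<dots> \<le> exp (2 * E t)" unfolding 1 by simp
  finally have "exp (- 2 * E t) * (2 * b t * J t) \<le> exp (- 2 * E t) * exp (2 * E t)"
    by (intro mult_left_mono) auto
  then show ?thesis using w_eq[OF t] by (simp add: mult_exp_exp mult_ac)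
qed

lemma w_mono:
  assumes "0 < s" "s \<le> t"
  shows "w s \<le> w t"
proof (rule DERIV_nonneg_imp_nondecreasing[OF assms(2)])
  fix x assume "s \<le> x"
  with \<open>0 < s\<close> have x: "0 < x" by simp
  then have "0 \<le> f x * (1 - 2 * (b x * w x))"
    using bw_le[of x] f_pos[of x] by (intro mult_nonneg_nonneg) auto
  then show "\<exists>y. (w has_real_derivative y) (at x) \<and> 0 \<le> y"
    using w_deriv[OF x] by blast
qed

lemma w_cont: "continuous_on {1..} w"
  by (intro continuous_at_imp_continuous_on ballI DERIV_isCont[OF w_deriv]) simp

text \<open>Here \<open>p\<^sup>2 = 4 * w\<close>, so \<open>p p' = 2 * f * (1 - 2 * b * w)\<close>.
  If \<open>4 * b * w \<ge> 1\<close>, the right-hand side is nonpositive; otherwise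
  \<open>1 - 2 * b * w > 1 / 2\<close> and \<open>p p'\<close> exceeds \<open>f\<close>.\<close>

lemma exists_subsol:
  assumes unb: "\<And>c. \<exists>t\<ge>1. c \<le> integral {1..t} (\<lambda>s. 1 / (2 * sqrt (w s)))"
  shows "\<exists>u :: real^'n \<Rightarrow> real. visc_subsol f g q u"
proof (rule visc_subsol_exists[OF _ _ unb])
  show "continuous_on {1..} (\<lambda>t. 2 * sqrt (w t))" by (intro continuous_intros w_cont)
  show "0 < 2 * sqrt (w t)" if "1 \<le> t" for t using w_pos[of t] that by simp
  fix t :: real assume t: "1 < t"
  have wt: "0 < w t" using w_pos t by simp
  have ge: "g t * (2 * sqrt (w t)) powr q = - (f t * (b t * (4 * w t)) powr (q / 2))"
    using g_eq[of "2 * sqrt (w t)" t] wt by (simp add: power_mult_distrib)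
  show "f t + g t * (2 * sqrt (w t)) powr q \<le> 0 \<or>
      (\<exists>D. ((\<lambda>t. 2 * sqrt (w t)) has_real_derivative D) (at t) \<and>
        f t + g t * (2 * sqrt (w t)) powr q \<le> 2 * sqrt (w t) * D)"
  proof (cases "1 \<le> b t * (4 * w t)")
    case True
    then have "1 \<le> (b t * (4 * w t)) powr (q / 2)" using q ge_one_powr_ge_zero by simp
    then have "f t * 1 \<le> f t * (b t * (4 * w t)) powr (q / 2)"
      using f_pos by (intro mult_left_mono) (auto simp: less_imp_le)
    then show ?thesis using ge by simp
  next
    case False
    have "((\<lambda>t. 2 * sqrt (w t)) has_real_derivative 2 * (inverse (sqrt (w t)) / 2 * (f t * (1 - 2 * (b t * w t))))) (at t)"
      by (intro DERIV_cmult DERIV_chain2[OF DERIV_real_sqrt] w_deriv wt) (use t in auto)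
    moreover have "f t + g t * (2 * sqrt (w t)) powr q \<le> f t * (2 * (1 - 2 * (b t * w t)))"
    proof -
      have "f t * 1 \<le> f t * (2 * (1 - 2 * (b t * w t)))"
        using f_pos False by (intro mult_left_mono) (auto simp: less_imp_le)
      moreover have "0 \<le> f t * (b t * (4 * w t)) powr (q / 2)" using f_pos[of t] by simp
      ultimately show ?thesis using ge by simp
    qed
    moreover have "2 * sqrt (w t) * (2 * (inverse (sqrt (w t)) / 2 * (f t * (1 - 2 * (b t * w t)))))
        = f t * (2 * (1 - 2 * (b t * w t)))"
      using wt by (simp add: field_simps)
    ultimately show ?thesis by metis
  qed
qed

text \<open>For the profile \<open>e * sqrt (w t)\<close>, each of \<open>p p'\<close>,
  \<open>p\<close> and the loss from the gradient term is at most \<open>f t / 4\<close>.\<close>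

lemma no_subsol:
  fixes u :: "real^'n \<Rightarrow> real"
  assumes bd: "\<exists>T. \<forall>t\<ge>1. integral {1..t} (\<lambda>s. 1 / sqrt (w s)) \<le> T"
  shows "\<not> visc_subsol f g q u"
proof -
  obtain T where T: "\<And>t. 1 \<le> t \<Longrightarrow> integral {1..t} (\<lambda>s. 1 / sqrt (w s)) \<le> T" using bd by blast
  have c: "continuous_on {1..} (\<lambda>t. sqrt (w t))" by (intro continuous_intros w_cont)
  obtain B where B: "0 < B" "\<And>t. 1 \<le> t \<Longrightarrow> t \<le> B * sqrt (w t)"
  proof (rule linear_bound_of_integral_bounded[OF c _ _ T])
    show "0 < sqrt (w t)" if "1 \<le> t" for t using w_pos that by simp
    show "sqrt (w s) \<le> sqrt (w t)" if "1 \<le> s" "s \<le> t" for s t using w_mono that by simp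
  qed auto
  show ?thesis
  proof (rule no_visc_subsol[OF q f_mono f_pos g_mono, where \<kappa> = 1 and A = 1])
    fix \<eta> :: real assume \<eta>: "0 < \<eta>"
    have w1: "0 < sqrt (w 1)" using w_pos by simp
    \<comment> \<open>The entries yield, in order: \<open>p p' \<le> f / 4\<close>;
      \<open>p \<le> f / 4\<close>, through \<open>sqrt w \<le> B * f\<close>; a gradient loss of at
      most \<open>f / 4\<close>, through \<open>b * w \<le> 1 / 2\<close>; and
      \<open>p 1 \<le> \<eta> / 2\<close>.\<close>
    define e where "e = Min {1 / 2, 1 / (4 * B), sqrt (2 * (1 / 4) powr (2 / q)), \<eta> / (2 * sqrt (w 1))}"
    have e: "0 < e" "e \<le> 1 / 2" "e \<le> 1 / (4 * B)" "e \<le> sqrt (2 * (1 / 4) powr (2 / q))" "e \<le> \<eta> / (2 * sqrt (w 1))"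
      using B w1 \<eta> by (auto simp: e_def)
    have e2: "e\<^sup>2 \<le> 1 / 2" using power_mono[OF e(2), of 2] e(1) by (simp add: power2_eq_square)
    have e3: "e\<^sup>2 \<le> 2 * (1 / 4) powr (2 / q)"
      using power_mono[OF e(4), of 2] e(1) by simp
    show "\<exists>p T. p 1 < \<eta> \<and> (\<forall>t\<ge>1. 0 < p t \<and> integral {1..t} (\<lambda>s. 1 / p s) \<le> T \<and>
      (\<exists>D. (p has_real_derivative D) (at t) \<and> max (p t * D) 0 + 1 * p t \<le> f t + g t * p t powr q))"
    proof (rule exI[of _ "\<lambda>t. e * sqrt (w t)"], rule exI[of _ "1 / e * T"], intro conjI allI impI)
      have "e * sqrt (w 1) \<le> \<eta> / 2" using e(5) w1 by (simp add: field_simps)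
      then show "e * sqrt (w 1) < \<eta>" using \<eta> by simp
      fix t :: real assume t: "1 \<le> t"
      have wt: "0 < w t" using w_pos t by simp
      show "0 < e * sqrt (w t)" using e wt by simp
      have "integral {1..t} (\<lambda>s. 1 / (e * sqrt (w s))) = integral {1..t} (\<lambda>s. 1 / e * (1 / sqrt (w s)))"
        by simp
      also have "\<dots> \<le> 1 / e * T"
        unfolding Henstock_Kurzweil_Integration.integral_mult_right
        using T[OF t] e by (intro mult_left_mono) auto
      finally show "integral {1..t} (\<lambda>s. 1 / (e * sqrt (w s))) \<le> 1 / e * T" .
      let ?D = "e * (inverse (sqrt (w t)) / 2 * (f t * (1 - 2 * (b t * w t))))"
      have D: "((\<lambda>t. e * sqrt (w t)) has_real_derivative ?D) (at t)"
        by (intro DERIV_cmult DERIV_chain2[OF DERIV_real_sqrt] w_deriv wt) (use t in auto)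
      have bw: "0 \<le> b t * w t" "b t * w t \<le> 1 / 2" using b_nonneg wt bw_le t by auto
      have 1: "e * sqrt (w t) * ?D \<le> f t / 4"
      proof -
        have "e * sqrt (w t) * ?D = e\<^sup>2 * (f t / 2 * (1 - 2 * (b t * w t)))"
          using wt by (simp add: field_simps power2_eq_square)
        also have "\<dots> \<le> 1 / 2 * (f t / 2 * 1)"
          using e2 bw f_pos[of t] by (intro mult_mono) auto
        finally show ?thesis by simp
      qed
      have 2: "e * sqrt (w t) \<le> f t / 4"
      proof -
        have "sqrt (w t) * sqrt (w t) \<le> t * f t" using w_le[of t] t wt by simp
        also have "\<dots> \<le> B * sqrt (w t) * f t" using B(2)[OF t] f_pos[of t] by (intro mult_right_mono) auto
        finally have "sqrt (w t) * sqrt (w t) \<le> sqrt (w t) * (B * f t)" by (simp add: mult_ac)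
        then have "sqrt (w t) \<le> B * f t"
          by (rule mult_left_le_imp_le) (use wt in simp)
        then have "e * sqrt (w t) \<le> 1 / (4 * B) * (B * f t)"
          using e B wt by (intro mult_mono) auto
        then show ?thesis using B by simp
      qed
      have 3: "- (f t / 4) \<le> g t * (e * sqrt (w t)) powr q"
      proof -
        have "(b t * (e * sqrt (w t))\<^sup>2) = e\<^sup>2 * (b t * w t)" using wt by (simp add: power_mult_distrib)
        also have "\<dots> \<le> 2 * (1 / 4) powr (2 / q) * (1 / 2)" using e3 bw by (intro mult_mono) auto
        finally have "(b t * (e * sqrt (w t))\<^sup>2) powr (q / 2) \<le> ((1 / 4) powr (2 / q)) powr (q / 2)"
          using q b_nonneg by (intro powr_mono2) auto
        also have "\<dots> = 1 / 4" using q by (simp add: powr_powr)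
        finally have "f t * (b t * (e * sqrt (w t))\<^sup>2) powr (q / 2) \<le> f t * (1 / 4)"
          using f_pos[of t] by (intro mult_left_mono) auto
        then show ?thesis using g_eq[of "e * sqrt (w t)" t] e wt by simp
      qed
      have "max (e * sqrt (w t) * ?D) 0 + 1 * (e * sqrt (w t)) \<le> f t + g t * (e * sqrt (w t)) powr q"
      proof -
        have "max (e * sqrt (w t) * ?D) 0 \<le> f t / 4"
          by (rule max.boundedI[OF 1]) (use f_pos[of t] in simp)
        then show ?thesis using 2 3 f_pos[of t] by linarith
      qed
      then show "\<exists>D. ((\<lambda>t. e * sqrt (w t)) has_real_derivative D) (at t) \<and>
          max (e * sqrt (w t) * D) 0 + 1 * (e * sqrt (w t)) \<le> f t + g t * (e * sqrt (w t)) powr q"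
        using D by blast
    qed
  qed simp
qed

section \<open>Bounds on \<open>1 / sqrt (w t)\<close>\<close>

lemma w_near:
  assumes "0 \<le> t" "t \<le> 1"
  shows "1 / sqrt (w t) \<le> 1 / sqrt (exp (- 2 * (E 1 - E 0)) * f 0) * (t powr (- 1 / 2) + 1)"
proof (cases "t = 0")
  case True
  then show ?thesis using f_pos[of 0] by (simp add: w_def)
next
  case False
  define c where "c = exp (- 2 * (E 1 - E 0)) * f 0"
  have c: "0 < c" using f_pos by (simp add: c_def)
  have t: "0 < t" using assms False by simp
  have "c \<le> exp (- 2 * (E t - E 0)) * f 0"
    unfolding c_def using E_mono[of t 1] assms f_pos[of 0] by (intro mult_right_mono) auto
  then have "t * c \<le> t * (exp (- 2 * (E t - E 0)) * f 0)" using t by (intro mult_left_mono) auto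
  also have "\<dots> \<le> w t" using w_lower[of 0 t] t by (simp add: mult_ac)
  finally have "1 / sqrt (w t) \<le> 1 / sqrt (t * c)"
    using t c by (intro divide_left_mono) (auto simp: w_pos)
  also have "\<dots> = 1 / sqrt c * t powr (- 1 / 2)"
    unfolding inverse_sqrt_powr[OF t, symmetric] by (simp add: real_sqrt_mult)
  also have "\<dots> \<le> 1 / sqrt c * (t powr (- 1 / 2) + 1)" using c by (intro mult_left_mono) auto
  finally show ?thesis by (simp add: c_def)
qed

text \<open>Two upper bounds for \<open>w\<close> meet: \<open>w t \<le> t * f t\<close>, and
  \<open>b t * w t \<le> 1 / 2\<close> with \<open>b t \<ge> (l / f t) powr (2 / q)\<close>.
  Divergence of the integral for a negative limit thus passes to \<open>1 / sqrt w\<close>.\<close>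

lemma w_upper_of_neg:
  assumes l: "0 < l" "\<And>t. g t \<le> - l" and t: "0 < t"
  shows "1 / sqrt (t * f t) + 1 / f t powr (1 / q) \<le> (2 * (1 + 1 / l powr (1 / q))) * (1 / (2 * sqrt (w t)))"
proof -
  have w: "0 < w t" "0 < sqrt (w t)" using w_pos t by auto
  have f: "0 < f t" by (rule f_pos)
  have "1 / sqrt (t * f t) \<le> 1 / sqrt (w t)"
    using w w_le[of t] t f by (intro divide_left_mono) auto
  moreover have "1 / f t powr (1 / q) \<le> 1 / l powr (1 / q) * (1 / sqrt (w t))"
  proof -
    have "(l / f t) powr (2 / q) \<le> b t"
      unfolding b_def using l(2)[of t] l(1) q f by (intro powr_mono2 divide_right_mono) auto
    then have "(l / f t) powr (2 / q) * w t \<le> b t * w t" using w by (intro mult_right_mono) auto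
    also have "\<dots> \<le> 1" using bw_le[of t] t by simp
    also have "(l / f t) powr (2 / q) = ((l / f t) powr (1 / q))\<^sup>2"
      using l f by (simp add: powr_power)
    finally have "sqrt (((l / f t) powr (1 / q))\<^sup>2 * w t) \<le> 1" by simp
    then have "(l / f t) powr (1 / q) * sqrt (w t) \<le> 1" by (simp add: real_sqrt_mult)
    then show ?thesis using l f w by (simp add: powr_divide field_simps)
  qed
  ultimately have "1 / sqrt (t * f t) + 1 / f t powr (1 / q) \<le> 1 / sqrt (w t) + 1 / l powr (1 / q) * (1 / sqrt (w t))"
    by (rule add_mono)
  also have "\<dots> = (2 * (1 + 1 / l powr (1 / q))) * (1 / (2 * sqrt (w t)))"
    by (simp add: add_divide_distrib distrib_left distrib_right)
  finally show ?thesis .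
qed

text \<open>The exponential weight is harmless on a last stretch before \<open>t\<close> where
  \<open>b * f\<close> integrates to at most 1. Since \<open>q \<le> 2\<close>,
  \<open>f powr (1 - 2 / q)\<close> is nonincreasing, so \<open>\<Lambda>\<close> bounds
  \<open>b * f\<close> from \<open>t / 2\<close> on, and the length
  \<open>min (t / 2) (1 / \<Lambda>)\<close> works. Bounding its reciprocal by a sum produces the
  two terms of the integrand.\<close>

lemma w_lower_half:
  assumes q2: "q \<le> 2" and t: "0 < t"
  shows "1 / sqrt (w t) \<le> exp 1 * (1 + sqrt (max (- g 0) 0 powr (2 / q) + 1)) *
    (1 / sqrt (t / 2 * f (t / 2)) + 1 / f (t / 2) powr (1 / q))"
proof -
  define h where "h = t / 2"
  have h: "0 < h" "h < t" using t by (simp_all add: h_def)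
  \<comment> \<open>The \<open>+ 1\<close> keeps \<open>\<Lambda>\<close> positive when
    \<open>g 0 = 0\<close>.\<close>
  define C where "C = max (- g 0) 0 powr (2 / q) + 1"
  have C: "0 < C" by (simp add: C_def add_nonneg_pos)
  have fh: "0 < f h" by (rule f_pos)
  define \<Lambda> where "\<Lambda> = C * f h powr (1 - 2 / q)"
  have L: "0 < \<Lambda>" using C fh by (simp add: \<Lambda>_def)
  have bf: "b r * f r \<le> \<Lambda>" if "h \<le> r" for r
  proof -
    have fr: "0 < f r" by (rule f_pos)
    have "b r * f r \<le> (max (- g 0) 0 / f r) powr (2 / q) * f r"
      unfolding b_def using q fr h that monoD[OF g_mono, of 0 r] g_nonpos
      by (intro mult_right_mono powr_mono2 divide_right_mono) (auto simp: divide_nonpos_pos)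
    also have "\<dots> = max (- g 0) 0 powr (2 / q) * f r powr (1 - 2 / q)"
      using fr by (simp add: powr_divide powr_diff)
    also have "\<dots> \<le> C * f h powr (1 - 2 / q)"
      using C q q2 fh f_le[OF that] by (intro mult_mono powr_mono2') (auto simp: C_def field_simps)
    finally show ?thesis by (simp add: \<Lambda>_def)
  qed
  define \<sigma> where "\<sigma> = min h (1 / \<Lambda>)"
  have s: "0 < \<sigma>" "\<sigma> \<le> h" "\<sigma> * \<Lambda> \<le> 1"
    using h L mult_right_mono[of \<sigma> "1 / \<Lambda>" \<Lambda>] by (auto simp: \<sigma>_def)
  have ts: "h \<le> t - \<sigma>" using s by (simp add: h_def)
  have "E t - E (t - \<sigma>) = integral {t - \<sigma>..t} (\<lambda>\<tau>. b \<tau> * f \<tau>)"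
    using E_diff[of "t - \<sigma>" t] ts h s by simp
  also have "\<dots> \<le> integral {t - \<sigma>..t} (\<lambda>\<tau>. \<Lambda>)"
    using bf ts by (intro integral_le integrable_continuous_interval bf_cont) auto
  also have "\<dots> \<le> 1" using s by simp
  finally have E1: "exp (- 2) \<le> exp (- 2 * (E t - E (t - \<sigma>)))" by simp
  have "\<sigma> * exp (- 2) * f h \<le> \<sigma> * exp (- 2 * (E t - E (t - \<sigma>))) * f (t - \<sigma>)"
    using E1 s fh f_le[OF ts] by (intro mult_mono) auto
  also have "\<dots> \<le> w t" using w_lower[of "t - \<sigma>" t] ts h s by simp
  finally have "1 / w t \<le> 1 / (\<sigma> * exp (- 2) * f h)"
    using s fh w_pos[OF t] by (intro divide_left_mono) auto
  also have "\<dots> = (exp 1)\<^sup>2 / f h * (1 / \<sigma>)"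
    by (simp add: exp_minus field_simps flip: exp_double)
  also have "\<dots> \<le> (exp 1)\<^sup>2 / f h * (1 / h + \<Lambda>)"
    using fh h L by (intro mult_left_mono) (auto simp: \<sigma>_def min_def)
  also have "\<dots> = (exp 1)\<^sup>2 * (1 / (h * f h) + C * (1 / f h powr (1 / q))\<^sup>2)"
  proof -
    have "f h powr (1 - 2 / q) = f h * (1 / f h powr (1 / q))\<^sup>2"
      using fh by (simp add: powr_diff power_divide powr_power)
    then show ?thesis using fh h by (simp add: \<Lambda>_def field_simps)
  qed
  finally have "sqrt (1 / w t) \<le> sqrt ((exp 1)\<^sup>2 * (1 / (h * f h) + C * (1 / f h powr (1 / q))\<^sup>2))"
    by (rule real_sqrt_le_mono)
  also have "\<dots> \<le> exp 1 * (sqrt (1 / (h * f h)) + sqrt (C * (1 / f h powr (1 / q))\<^sup>2))"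
    unfolding real_sqrt_mult[of "(exp 1)\<^sup>2"] using h fh C
    by (simp only: real_sqrt_abs) (intro mult_mono sqrt_add_le_add_sqrt, auto simp: less_imp_le)
  also have "\<dots> = exp 1 * (1 / sqrt (h * f h) + sqrt C * (1 / f h powr (1 / q)))"
    by (simp add: real_sqrt_mult real_sqrt_divide)
  also have "\<dots> \<le> exp 1 * ((1 + sqrt C) * (1 / sqrt (h * f h)) + (1 + sqrt C) * (1 / f h powr (1 / q)))"
    using h fh C by (intro mult_left_mono add_mono mult_right_mono) (auto simp: field_simps)
  also have "\<dots> = exp 1 * (1 + sqrt C) * (1 / sqrt (h * f h) + 1 / f h powr (1 / q))"
    by (simp only: distrib_left[symmetric] mult.assoc)
  also have "sqrt (1 / w t) = 1 / sqrt (w t)" by (simp add: real_sqrt_divide)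
  finally show ?thesis by (simp only: h_def C_def)
qed

end

section \<open>Eventually positive gradient terms\<close>

lemma half_le_integral:
  fixes \<phi> :: "real \<Rightarrow> real"
  assumes c: "continuous_on UNIV \<phi>" and m: "mono \<phi>" and nn: "\<And>t. 0 \<le> \<phi> t" and t: "0 \<le> t"
  shows "t / 2 * \<phi> (t / 2) \<le> integral {0..t} \<phi>"
proof -
  have i: "\<phi> integrable_on {x..y}" for x y
    by (intro integrable_continuous_interval continuous_on_subset[OF c]) auto
  have "t / 2 * \<phi> (t / 2) = integral {t / 2..t} (\<lambda>s. \<phi> (t / 2))" using t by simp
  also have "\<dots> \<le> integral {t / 2..t} \<phi>" by (intro integral_le i) (use monoD[OF m] in auto)
  also have "\<dots> \<le> integral {0..t / 2} \<phi> + integral {t / 2..t} \<phi>" by (simp add: integral_nonneg i nn)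
  also have "\<dots> = integral {0..t} \<phi>"
    by (intro Henstock_Kurzweil_Integration.integral_combine i) (use t in auto)
  finally show ?thesis .
qed

lemma integral_le_mult_mono:
  fixes \<phi> :: "real \<Rightarrow> real"
  assumes c: "continuous_on UNIV \<phi>" and m: "mono \<phi>" and t: "0 \<le> t"
  shows "integral {0..t} \<phi> \<le> t * \<phi> t"
proof -
  have "integral {0..t} \<phi> \<le> integral {0..t} (\<lambda>s. \<phi> t)"
    by (intro integral_le integrable_continuous_interval continuous_on_subset[OF c])
      (use monoD[OF m] in auto)
  then show ?thesis using t by simp
qed

lemma powr_add_le:
  fixes x y a :: real
  assumes "0 \<le> x" "0 \<le> y" "0 \<le> a" "a \<le> 1"
  shows "(x + y) powr a \<le> 2 * (x powr a + y powr a)"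
proof -
  have "(x + y) powr a \<le> (2 * max x y) powr a" using assms by (intro powr_mono2) auto
  also have "\<dots> = 2 powr a * max x y powr a" using assms by (simp add: powr_mult)
  also have "\<dots> \<le> 2 * (x powr a + y powr a)"
    using assms powr_mono[of a 1 2] by (intro mult_mono) (auto simp: max_def)
  finally show ?thesis .
qed

lemma powr_le_one_plus_powr:
  fixes x a b :: real
  assumes "0 < x" "0 \<le> a" "a \<le> b"
  shows "x powr a \<le> 1 + x powr b"
proof (cases "x \<le> 1")
  case True
  then have "x powr a \<le> 1" using powr_mono2[of a x 1] assms by simp
  then show ?thesis by (simp add: add_increasing2)
next
  case False
  then have "x powr a \<le> x powr b" using assms by (intro powr_mono) auto
  then show ?thesis by simp
qed

text \<open>With \<open>y\<close> affine, \<open>p = y powr q\<close> has \<open>p p'\<close> of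
  order \<open>y powr (2 * q - 1)\<close>, while \<open>g * p powr q\<close> is at least of order
  \<open>y powr (q * q)\<close>. As \<open>2 * q - 1 \<le> q * q\<close>, the gradient term wins,
  and \<open>q > 1\<close> makes \<open>1 / p\<close> integrable.\<close>

lemma no_subsol_superlinear_gradient:
  fixes f g :: "real \<Rightarrow> real" and u :: "real^'n \<Rightarrow> real"
  assumes q: "1 < q" and f: "strict_mono f" "\<And>t. 0 < f t" and g: "mono g" and gA: "0 < g A"
  shows "\<not> visc_subsol f g q u"
proof -
  define m where "m = min (f A) (g A)"
  have m: "0 < m" using f(2) gA by (simp add: m_def)
  \<comment> \<open>Then \<open>q * \<epsilon> = m / 2\<close>: half of the lower bound
    \<open>m * (1 + y powr (q * q))\<close> pays for \<open>p p'\<close>, the other half for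
    \<open>\<kappa> * p\<close>.\<close>
  define \<epsilon> where "\<epsilon> = m / (2 * q)"
  have e: "0 < \<epsilon>" using m q by (simp add: \<epsilon>_def)
  show ?thesis
  proof (rule no_visc_subsol[OF _ f g, where \<kappa> = "m / 2" and A = A])
    fix \<eta> :: real assume \<eta>: "0 < \<eta>"
    \<comment> \<open>Chosen to give \<open>p A = \<eta> / 2\<close>.\<close>
    define \<zeta> where "\<zeta> = (\<eta> / 2) powr (1 / q)"
    have z: "0 < \<zeta>" using \<eta> by (simp add: \<zeta>_def)
    define y where "y t = \<epsilon> * (t - A) + \<zeta>" for t
    have y: "0 < y t" if "A \<le> t" for t using that e z by (simp add: y_def add_nonneg_pos)
    have dy: "(y has_real_derivative \<epsilon>) (at t)" for t
      unfolding y_def by (auto intro!: derivative_eq_intros)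
    have dyp: "((\<lambda>t. y t powr r) has_real_derivative r * y t powr (r - 1) * \<epsilon>) (at t)" if "A \<le> t" for r t
      using DERIV_fun_powr[OF dy y[OF that], of r] by simp
    \<comment> \<open>An antiderivative of \<open>1 / y powr q\<close> that is nonpositive, so that
      \<open>- \<Psi> A\<close> bounds all the integrals.\<close>
    define \<Psi> where "\<Psi> t = - (y t powr (1 - q) / (\<epsilon> * (q - 1)))" for t
    show "\<exists>p T. p A < \<eta> \<and> (\<forall>t\<ge>A. 0 < p t \<and> integral {A..t} (\<lambda>s. 1 / p s) \<le> T \<and>
      (\<exists>D. (p has_real_derivative D) (at t) \<and> max (p t * D) 0 + m / 2 * p t \<le> f t + g t * p t powr q))"
    proof (rule exI[of _ "\<lambda>t. y t powr q"], rule exI[of _ "- \<Psi> A"], intro conjI allI impI)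
      show "y A powr q < \<eta>" using \<eta> q by (simp add: y_def \<zeta>_def powr_powr)
      fix t assume t: "A \<le> t"
      show "0 < y t powr q" using y[OF t] by simp
      have "((\<lambda>s. 1 / y s powr q) has_integral \<Psi> t - \<Psi> A) {A..t}"
      proof (rule fundamental_theorem_of_calculus[OF t])
        fix s assume "s \<in> {A..t}"
        then have ys: "0 < y s" using y by simp
        have "((\<lambda>t. - (y t powr (1 - q) / (\<epsilon> * (q - 1)))) has_real_derivative
            - ((1 - q) * y s powr (1 - q - 1) * \<epsilon> / (\<epsilon> * (q - 1)))) (at s within {A..t})"
          by (rule has_field_derivative_at_within, intro DERIV_minus DERIV_cdivide dyp) (use \<open>s \<in> {A..t}\<close> in simp)
        also have "- ((1 - q) * y s powr (1 - q - 1) * \<epsilon> / (\<epsilon> * (q - 1))) = 1 / y s powr q"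
        proof -
          have "(1 - q) * y s powr (1 - q - 1) * \<epsilon> = - (y s powr (- q)) * (\<epsilon> * (q - 1))"
            by (simp add: algebra_simps)
          moreover have "\<epsilon> * (q - 1) \<noteq> 0" using e q by simp
          ultimately show ?thesis by (simp add: powr_minus_divide)
        qed
        finally show "(\<Psi> has_vector_derivative 1 / y s powr q) (at s within {A..t})"
          unfolding \<Psi>_def[abs_def] has_real_derivative_iff_has_vector_derivative[symmetric] .
      qed
      then have "integral {A..t} (\<lambda>s. 1 / y s powr q) = \<Psi> t - \<Psi> A" by (rule integral_unique)
      moreover have "\<Psi> t \<le> 0" using e q by (simp add: \<Psi>_def)
      ultimately show "integral {A..t} (\<lambda>s. 1 / y s powr q) \<le> - \<Psi> A" by simp
      have D: "((\<lambda>t. y t powr q) has_real_derivative q * y t powr (q - 1) * \<epsilon>) (at t)"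
        by (intro dyp t)
      have ge: "m * (1 + y t powr (q * q)) \<le> f t + g t * (y t powr q) powr q"
      proof -
        have "m \<le> f t" "m \<le> g t"
          using f(1) monoD[OF g t] t by (auto simp: m_def min_le_iff_disj strict_mono_less_eq intro: order_trans)
        then have "m + m * y t powr (q * q) \<le> f t + g t * y t powr (q * q)"
          by (intro add_mono mult_right_mono) auto
        then show ?thesis by (simp add: powr_powr distrib_left)
      qed
      have a: "y t powr q * (q * y t powr (q - 1) * \<epsilon>) \<le> m / 2 * (1 + y t powr (q * q))"
      proof -
        have "0 \<le> (q - 1)\<^sup>2" by simp
        then have "2 * q - 1 \<le> q * q" by (simp add: power2_eq_square algebra_simps)
        then have le: "y t powr (2 * q - 1) \<le> 1 + y t powr (q * q)"
          using y[OF t] q by (intro powr_le_one_plus_powr) auto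
        have "y t powr q * (q * y t powr (q - 1) * \<epsilon>) = q * \<epsilon> * (y t powr q * y t powr (q - 1))" by simp
        also have "y t powr q * y t powr (q - 1) = y t powr (2 * q - 1)" by (simp flip: powr_add)
        also have "q * \<epsilon> = m / 2" using q by (simp add: \<epsilon>_def)
        finally show ?thesis using le m by simp
      qed
      have b: "y t powr q \<le> 1 + y t powr (q * q)"
        using y[OF t] q by (intro powr_le_one_plus_powr) auto
      have "max (y t powr q * (q * y t powr (q - 1) * \<epsilon>)) 0 \<le> m / 2 * (1 + y t powr (q * q))"
        by (rule max.boundedI[OF a]) (use m in simp)
      moreover have "m / 2 * y t powr q \<le> m / 2 * (1 + y t powr (q * q))"
        using b m by (intro mult_left_mono) auto
      ultimately have "max (y t powr q * (q * y t powr (q - 1) * \<epsilon>)) 0 + m / 2 * y t powr q \<le> f t + g t * (y t powr q) powr q"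
        using ge by (simp add: field_simps)
      then show "\<exists>D. ((\<lambda>t. y t powr q) has_real_derivative D) (at t) \<and>
          max (y t powr q * D) 0 + m / 2 * y t powr q \<le> f t + g t * (y t powr q) powr q"
        using D by blast
    qed
  qed (use q m in auto)
qed

section \<open>Gradient exponents at most one\<close>

locale sublinear_gradient_term =
  fixes f g :: "real \<Rightarrow> real" and q :: real
  assumes q: "0 < q" "q \<le> 1"
    and f_cont: "continuous_on UNIV f" and g_cont: "continuous_on UNIV g"
    and f_mono: "strict_mono f" and g_mono: "mono g"
    and f_pos: "0 < f t"
begin

text \<open>The exponent of the pure gradient balance: where \<open>g > 0\<close>,
  \<open>p p' = g * p powr q\<close> is solved by
  \<open>p = ((2 - q) * G) powr \<alpha>\<close>.\<close>

definition \<alpha> :: real where "\<alpha> = 1 / (2 - q)"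

definition F :: "real \<Rightarrow> real" where "F t = integral {0..t} f"

definition G :: "real \<Rightarrow> real" where "G t = integral {0..t} (\<lambda>s. max (g s) 0)"

definition h :: "real \<Rightarrow> real" where
  "h t = 1 / (sqrt (t * f t) + (t * max (g t) 0) powr \<alpha>)"

lemma \<alpha>: "0 < \<alpha>" "\<alpha> \<le> 1" "1 \<le> 2 * \<alpha>" "2 * \<alpha> - 1 = q * \<alpha>"
  "(2 - q) / 2 * \<alpha> = 1 / 2" "\<alpha> * (2 - q) = 1"
  using q by (auto simp: \<alpha>_def field_simps)

lemma gp_cont: "continuous_on S (\<lambda>s. max (g s) 0)"
  by (rule continuous_on_subset[of UNIV]) (auto intro!: continuous_intros g_cont)

lemma gp_mono: "mono (\<lambda>s. max (g s) 0)"
  using g_mono by (auto simp: mono_def max_def intro: order_trans)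

lemma f_mono': "mono f"
  using f_mono by (rule strict_mono_mono)

lemma FG_deriv:
  assumes "0 < t"
  shows "(F has_real_derivative f t) (at t)" "(G has_real_derivative max (g t) 0) (at t)"
  unfolding F_def G_def
  using has_real_derivative_integral[OF f_cont assms] has_real_derivative_integral[OF gp_cont assms] by auto

lemma FG_bounds:
  assumes "0 \<le> t"
  shows "t / 2 * f (t / 2) \<le> F t" "F t \<le> t * f t"
    "t / 2 * max (g (t / 2)) 0 \<le> G t" "G t \<le> t * max (g t) 0" "0 \<le> F t" "0 \<le> G t"
proof -
  show 1: "t / 2 * f (t / 2) \<le> F t" "F t \<le> t * f t"
    unfolding F_def
    using half_le_integral[OF f_cont f_mono' less_imp_le[OF f_pos] assms] integral_le_mult_mono[OF f_cont f_mono' assms] by auto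
  show 2: "t / 2 * max (g (t / 2)) 0 \<le> G t" "G t \<le> t * max (g t) 0"
    unfolding G_def using half_le_integral[OF gp_cont gp_mono _ assms] integral_le_mult_mono[OF gp_cont gp_mono assms] by auto
  have "0 \<le> t / 2 * f (t / 2)" "0 \<le> t / 2 * max (g (t / 2)) 0" using assms f_pos[of "t / 2"] by auto
  then show "0 \<le> F t" "0 \<le> G t" using 1 2 by linarith+
qed

lemma h_measurable: "h \<in> borel_measurable borel"
proof -
  have [measurable]: "f \<in> borel_measurable borel" "g \<in> borel_measurable borel"
    using f_cont g_cont by (auto intro: borel_measurable_continuous_onI)
  show ?thesis unfolding h_def[abs_def] by measurable
qed

text \<open>The profile adds the \<open>(2 - q)\<close>-th powers of the pure solutions
  \<open>sqrt (1 + 2 * F)\<close> and \<open>((2 - q) * G) powr \<alpha>\<close>. Then \<open>p p' =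
  p powr q * (f * (1 + 2 * F) powr (- (q / 2)) + max g 0)\<close>, and
  \<open>p \<ge> sqrt (1 + 2 * F)\<close> makes the first part at least \<open>f\<close>.\<close>

lemma exists_subsol:
  assumes inf: "(\<integral>\<^sup>+t\<in>{0..}. ennreal (h t) \<partial>lborel) = \<infinity>"
  shows "\<exists>u :: real^'n \<Rightarrow> real. visc_subsol f g q u"
proof -
  define z where "z t = (1 + 2 * F t) powr ((2 - q) / 2) + (2 - q) * G t" for t
  define p where "p t = z t powr \<alpha>" for t
  have F1: "0 < 1 + 2 * F t" if "1 \<le> t" for t using FG_bounds(5)[of t] that by simp
  have z: "(1 + 2 * F t) powr ((2 - q) / 2) \<le> z t" "0 < z t" if "1 \<le> t" for t
  proof -
    show 1: "(1 + 2 * F t) powr ((2 - q) / 2) \<le> z t"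
      using FG_bounds(6)[of t] that q by (simp add: z_def)
    show "0 < z t" by (rule less_le_trans[OF _ 1]) (use F1[OF that] in simp)
  qed
  have p: "0 < p t" if "1 \<le> t" for t using z(2)[OF that] by (simp add: p_def)
  define D where "D t = \<alpha> * z t powr (\<alpha> - 1) * ((2 - q) / 2 * (1 + 2 * F t) powr ((2 - q) / 2 - 1) * (2 * f t) + (2 - q) * max (g t) 0)" for t
  have dp: "(p has_real_derivative D t) (at t)" if "1 \<le> t" for t
  proof -
    have t: "0 < t" using that by simp
    have "((\<lambda>t. 1 + 2 * F t) has_real_derivative 2 * f t) (at t)"
      by (auto intro!: derivative_eq_intros FG_deriv[OF t])
    from DERIV_fun_powr[OF this F1[OF that], of "(2 - q) / 2"]
    have "(z has_real_derivative (2 - q) / 2 * (1 + 2 * F t) powr ((2 - q) / 2 - 1) * (2 * f t) + (2 - q) * max (g t) 0) (at t)"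
      unfolding z_def[abs_def] by (intro DERIV_add DERIV_cmult FG_deriv[OF t]) simp
    from DERIV_fun_powr[OF this z(2)[OF that], of \<alpha>] show ?thesis
      unfolding p_def[abs_def] D_def by simp
  qed
  have c: "continuous_on {1..} p"
    by (intro continuous_at_imp_continuous_on ballI DERIV_isCont[OF dp]) simp
  \<comment> \<open>For \<open>t \<ge> 1\<close> one has \<open>f 0 \<le> t * f t\<close>, so the 1
    in \<open>1 + 2 * F t\<close> is absorbed into \<open>t * f t\<close>.\<close>
  define c1 where "c1 = sqrt (1 / f 0 + 2)"
  have c1: "0 < c1" using f_pos[of 0] by (simp add: c1_def add_pos_pos)
  have ple: "p t \<le> (2 * (c1 + 2)) * (sqrt (t * f t) + (t * max (g t) 0) powr \<alpha>)" if t: "1 \<le> t" for t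
  proof -
    have "p t \<le> 2 * (((1 + 2 * F t) powr ((2 - q) / 2)) powr \<alpha> + ((2 - q) * G t) powr \<alpha>)"
      unfolding p_def z_def using \<alpha> q FG_bounds(6)[of t] t by (intro powr_add_le) auto
    also have "((1 + 2 * F t) powr ((2 - q) / 2)) powr \<alpha> = sqrt (1 + 2 * F t)"
      unfolding powr_powr \<alpha>(5) using F1[OF t] by (simp add: powr_half_sqrt)
    also have "sqrt (1 + 2 * F t) \<le> c1 * sqrt (t * f t)"
    proof -
      have "f 0 \<le> 1 * f t" using t monoD[OF f_mono', of 0 t] by simp
      also have "\<dots> \<le> t * f t" using t f_pos[of t] by (intro mult_right_mono) auto
      finally have "f 0 \<le> t * f t" .
      then have "1 \<le> t * f t * (1 / f 0)" using f_pos[of 0] by (simp add: field_simps)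
      then have "1 + 2 * F t \<le> (1 / f 0 + 2) * (t * f t)"
        using FG_bounds(2)[of t] t by (simp add: algebra_simps)
      then show ?thesis unfolding c1_def real_sqrt_mult[symmetric] by (rule real_sqrt_le_mono)
    qed
    also have "((2 - q) * G t) powr \<alpha> \<le> 2 * (t * max (g t) 0) powr \<alpha>"
    proof -
      have "((2 - q) * G t) powr \<alpha> \<le> (2 * (t * max (g t) 0)) powr \<alpha>"
        using FG_bounds(4,6)[of t] t q \<alpha> by (intro powr_mono2 mult_mono) auto
      also have "\<dots> = 2 powr \<alpha> * (t * max (g t) 0) powr \<alpha>" using t by (simp add: powr_mult)
      also have "\<dots> \<le> 2 * (t * max (g t) 0) powr \<alpha>"
        using powr_mono[of \<alpha> 1 2] \<alpha> by (intro mult_right_mono) auto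
      finally show ?thesis .
    qed
    also have "2 * (c1 * sqrt (t * f t) + 2 * (t * max (g t) 0) powr \<alpha>) \<le>
        2 * ((c1 + 2) * sqrt (t * f t) + (c1 + 2) * (t * max (g t) 0) powr \<alpha>)"
      using c1 t f_pos[of t] by (intro mult_left_mono add_mono mult_right_mono) auto
    also have "\<dots> = (2 * (c1 + 2)) * (sqrt (t * f t) + (t * max (g t) 0) powr \<alpha>)"
      by (simp only: distrib_left[symmetric] mult.assoc)
    finally show ?thesis by simp
  qed
  have unb: "\<exists>t\<ge>1. c \<le> integral {1..t} (\<lambda>s. 1 / p s)" for c
  proof (rule integral_unbounded_of_nn_integral_infinite[OF inf _ c p])
    fix t :: real assume t: "0 \<le> t" "t \<le> 1"
    show "h t \<le> 1 / sqrt (f 0) * (t powr (- 1 / 2) + 1)"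
    proof (cases "t = 0")
      case True
      then show ?thesis using f_pos[of 0] by (simp add: h_def)
    next
      case False
      then have t0: "0 < t" using t by simp
      have "t * f 0 \<le> t * f t" using t monoD[OF f_mono', of 0 t] by (intro mult_left_mono) auto
      then have "sqrt (t * f 0) \<le> sqrt (t * f t) + (t * max (g t) 0) powr \<alpha>"
        by (simp add: add_increasing2)
      then have "h t \<le> 1 / sqrt (t * f 0)"
        unfolding h_def using t0 f_pos by (intro divide_left_mono mult_pos_pos add_pos_nonneg) auto
      also have "\<dots> = 1 / sqrt (f 0) * t powr (- 1 / 2)"
        unfolding inverse_sqrt_powr[OF t0, symmetric] by (simp add: real_sqrt_mult)
      also have "\<dots> \<le> 1 / sqrt (f 0) * (t powr (- 1 / 2) + 1)"
        using f_pos[of 0] by (intro mult_left_mono) auto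
      finally show ?thesis .
    qed
  next
    fix t :: real assume t: "1 \<le> t"
    let ?d = "sqrt (t * f t) + (t * max (g t) 0) powr \<alpha>"
    have d: "0 < ?d" using t f_pos[of t] by (intro add_pos_nonneg) auto
    show "h t \<le> (2 * (c1 + 2)) * (1 / p t)"
      unfolding h_def using ple[OF t] p[OF t] d by (simp add: field_simps)
  qed (use c1 f_pos[of 0] in auto)
  show ?thesis
  proof (rule visc_subsol_exists[OF c p unb])
    fix t :: real assume t: "1 < t"
    then have t1: "1 \<le> t" by simp
    have "p t powr q = z t powr (\<alpha> * q)" by (simp add: p_def powr_powr)
    also have "\<alpha> * q = \<alpha> + (\<alpha> - 1)" using \<alpha>(4) by (simp add: mult.commute)
    also have "z t powr \<dots> = p t * z t powr (\<alpha> - 1)" by (simp only: p_def powr_add)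
    finally have pq: "p t powr q = p t * z t powr (\<alpha> - 1)" .
    have e1: "(2 - q) / 2 - 1 = - (q / 2)" by (simp add: field_simps)
    have "p t * D t = p t powr q * (\<alpha> * (2 - q)) * (f t * (1 + 2 * F t) powr (- (q / 2)) + max (g t) 0)"
    proof -
      have "P * (\<alpha> * Z * ((2 - q) / 2 * Y * (2 * x) + (2 - q) * m)) = P * Z * (\<alpha> * (2 - q)) * (x * Y + m)"
        for P Z Y x m :: real by (simp add: field_simps)
      then show ?thesis unfolding D_def pq e1 by blast
    qed
    also have "\<alpha> * (2 - q) = 1" by (rule \<alpha>(6))
    finally have pD: "p t * D t = p t powr q * (f t * (1 + 2 * F t) powr (- (q / 2))) + p t powr q * max (g t) 0"
      by (simp add: distrib_left)
    have "((1 + 2 * F t) powr ((2 - q) / 2)) powr \<alpha> \<le> p t"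
      unfolding p_def using z[OF t1] \<alpha> by (intro powr_mono2) auto
    then have "(1 + 2 * F t) powr (1 / 2) \<le> p t" by (simp only: powr_powr \<alpha>(5))
    then have "((1 + 2 * F t) powr (1 / 2)) powr q \<le> p t powr q"
      using q by (intro powr_mono2) auto
    then have "(1 + 2 * F t) powr (q / 2) \<le> p t powr q" by (simp add: powr_powr)
    then have "(1 + 2 * F t) powr (q / 2) * (f t * (1 + 2 * F t) powr (- (q / 2))) \<le> p t powr q * (f t * (1 + 2 * F t) powr (- (q / 2)))"
      using f_pos[of t] by (intro mult_right_mono) auto
    moreover have "(1 + 2 * F t) powr (q / 2) * (f t * (1 + 2 * F t) powr (- (q / 2))) = f t"
      using F1[OF t1] by (simp add: powr_minus)
    moreover have "g t * p t powr q \<le> p t powr q * max (g t) 0" 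
      unfolding mult.commute[of "p t powr q"] by (rule mult_right_mono) auto
    ultimately have "f t + g t * p t powr q \<le> p t * D t" using pD by simp
    then show "f t + g t * p t powr q \<le> 0 \<or> (\<exists>D. (p has_real_derivative D) (at t) \<and> f t + g t * p t powr q \<le> p t * D)"
      using dp[OF t1] by blast
  qed
qed

text \<open>Here \<open>p\<^sup>2 = e * F + (e * G) powr (2 * \<alpha>)\<close>. With
  \<open>e\<close> inside the power, \<open>(e * G) powr (2 * \<alpha> - 1)\<close> is the
  \<open>q / 2\<close>-th power of the second summand, hence at most \<open>p powr q\<close>; the
  derivative \<open>W\<close> of \<open>p\<^sup>2\<close> is then at most \<open>2 * e\<close> times
  the right-hand side.\<close>

lemma no_subsol:
  fixes u :: "real^'n \<Rightarrow> real"
  assumes fin: "(\<integral>\<^sup>+t\<in>{0..}. ennreal (h t) \<partial>lborel) \<noteq> \<infinity>" and A0: "1 \<le> A0" "0 < g A0"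
  shows "\<not> visc_subsol f g q u"
proof -
  \<comment> \<open>The factor 2 makes \<open>g\<close> positive at \<open>t / 2\<close> for
    \<open>t \<ge> A\<close>, hence \<open>G t > 0\<close>, where its powers are
    differentiable.\<close>
  define A where "A = 2 * A0"
  have A: "0 < A" "A0 \<le> A" using A0 by (simp_all add: A_def)
  have g: "0 < g t" if "A \<le> t" for t
    using monoD[OF g_mono, of A0 t] A A0 that by simp
  have FGp: "0 < F t" "0 < G t" if "A \<le> t" for t
  proof -
    have "0 < t / 2 * f (t / 2)" using that A f_pos by (intro mult_pos_pos) auto
    then show "0 < F t" using FG_bounds(1)[of t] that A by simp
    have "A0 \<le> t / 2" using that by (simp add: A_def)
    then have "0 < g (t / 2)" using monoD[OF g_mono, of A0 "t / 2"] A0 by simp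
    then have "0 < t / 2 * max (g (t / 2)) 0" using that A by (intro mult_pos_pos) auto
    then show "0 < G t" using FG_bounds(3)[of t] that A by simp
  qed
  have dFG: "(F has_real_derivative f t) (at t)" "(G has_real_derivative g t) (at t)" if "A \<le> t" for t
    using FG_deriv[of t] g[OF that] that A by (auto simp: max_def)
  define w where "w e t = e * F t + (e * G t) powr (2 * \<alpha>)" for e t
  define p where "p e t = sqrt (w e t)" for e t
  have w: "0 < w e t" if "0 < e" "A \<le> t" for e t
    using FGp[OF that(2)] that(1) by (simp add: w_def add_pos_nonneg)
  have p: "0 < p e t" if "0 < e" "A \<le> t" for e t using w[OF that] by (simp add: p_def)
  define W where "W e t = e * f t + 2 * \<alpha> * (e * G t) powr (2 * \<alpha> - 1) * (e * g t)" for e t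
  have dw: "(w e has_real_derivative W e t) (at t)" if "0 < e" "A \<le> t" for e t
  proof -
    have "((\<lambda>t. e * G t) has_real_derivative e * g t) (at t)" by (intro DERIV_cmult dFG that)
    moreover have "0 < e * G t" using FGp[OF that(2)] that by simp
    ultimately show ?thesis
      unfolding w_def[abs_def] W_def using DERIV_fun_powr[of "\<lambda>t. e * G t" "e * g t" t "2 * \<alpha>"]
      by (intro DERIV_add DERIV_cmult dFG that) simp
  qed
  have dp: "(p e has_real_derivative inverse (p e t) / 2 * W e t) (at t)" if "0 < e" "A \<le> t" for e t
    unfolding p_def by (intro DERIV_chain2[OF DERIV_real_sqrt] dw w that)
  have cp: "continuous_on {A..} (p e)" if "0 < e" for e
    by (intro continuous_at_imp_continuous_on ballI DERIV_isCont[OF dp[OF that]]) simp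
  have W0: "0 \<le> W e t" if "0 < e" "A \<le> t" for e t
    using that f_pos[of t] g[OF that(2)] \<alpha> by (auto simp: W_def intro!: add_nonneg_nonneg mult_nonneg_nonneg)
  have w_mono: "w e s \<le> w e t" if "0 < e" "A \<le> s" "s \<le> t" for e s t
    by (rule DERIV_nonneg_imp_nondecreasing[OF that(3)]) (use dw W0 that in \<open>meson order_trans\<close>)
  have hb: "1 / p 1 t \<le> 2 * h (t / 2)" if t: "A \<le> t" for t
  proof -
    have t0: "0 < t" using t A by simp
    let ?d = "sqrt (t / 2 * f (t / 2)) + (t / 2 * max (g (t / 2)) 0) powr \<alpha>"
    have d: "0 < ?d" using t0 f_pos[of "t / 2"] by (intro add_pos_nonneg) auto
    have "sqrt (t / 2 * f (t / 2)) \<le> p 1 t"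
      unfolding p_def using FG_bounds(1)[of t] t0 by (intro real_sqrt_le_mono) (simp add: w_def add_increasing2)
    moreover have "(t / 2 * max (g (t / 2)) 0) powr \<alpha> \<le> p 1 t"
    proof -
      have "(t / 2 * max (g (t / 2)) 0) powr \<alpha> \<le> G t powr \<alpha>"
        using FG_bounds(3)[of t] t0 \<alpha> by (intro powr_mono2) auto
      also have "\<dots> = sqrt (G t powr (2 * \<alpha>))"
        using FGp[OF t] by (simp add: powr_half_sqrt[symmetric] powr_powr)
      also have "\<dots> \<le> p 1 t"
        unfolding p_def using FGp[OF t] by (intro real_sqrt_le_mono) (simp add: w_def)
      finally show ?thesis .
    qed
    ultimately have "?d \<le> 2 * p 1 t" by simp
    then show ?thesis unfolding h_def using d p[of 1 t] t by (simp add: field_simps)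
  qed
  have "\<exists>T. \<forall>t\<ge>A. integral {A..t} (\<lambda>s. 1 / p 1 s) \<le> T"
    by (rule integral_bounded_of_nn_integral_finite[OF nn_integral_rescale_finite[OF fin h_measurable] cp p hb])
      (use A in auto)
  then obtain T where T: "\<And>t. A \<le> t \<Longrightarrow> integral {A..t} (\<lambda>s. 1 / p 1 s) \<le> T" by blast
  obtain B where B: "0 < B" "\<And>t. A \<le> t \<Longrightarrow> t \<le> B * p 1 t"
  proof (rule linear_bound_of_integral_bounded[OF cp p _ T A(1)])
    show "p 1 s \<le> p 1 t" if "A \<le> s" "s \<le> t" for s t using w_mono[of 1 s t] that by (simp add: p_def)
  qed auto
  have e_le: "e * p 1 t \<le> p e t" if e: "0 < e" "e \<le> 1" and t: "A \<le> t" for e t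
  proof -
    have "e * (e * F t) \<le> 1 * (e * F t)" using e FGp[OF t] by (intro mult_right_mono) auto
    moreover have "e powr 2 \<le> e powr (2 * \<alpha>)" using e \<alpha> by (intro powr_mono') auto
    then have "e\<^sup>2 * G t powr (2 * \<alpha>) \<le> (e * G t) powr (2 * \<alpha>)"
      using e FGp[OF t] by (simp add: powr_mult mult_right_mono)
    ultimately have "e\<^sup>2 * w 1 t \<le> w e t" by (simp add: w_def power2_eq_square algebra_simps)
    then have "sqrt (e\<^sup>2 * w 1 t) \<le> sqrt (w e t)" by (rule real_sqrt_le_mono)
    then show ?thesis using e by (simp add: p_def real_sqrt_mult)
  qed
  show ?thesis
  proof (rule no_visc_subsol[OF q(1) f_mono f_pos g_mono, where \<kappa> = "1 / (4 * B)" and A = A])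
    fix \<eta> :: real assume \<eta>: "0 < \<eta>"
    \<comment> \<open>The second entry gives
      \<open>p e A \<le> sqrt e * p 1 A \<le> \<eta> / 2\<close>, because
      \<open>2 * \<alpha> \<ge> 1\<close>.\<close>
    define e where "e = min (1 / 2) ((\<eta> / (2 * p 1 A))\<^sup>2)"
    have pA: "0 < p 1 A" using p by simp
    have e: "0 < e" "e \<le> 1 / 2" "e \<le> (\<eta> / (2 * p 1 A))\<^sup>2" using \<eta> pA by (auto simp: e_def)
    show "\<exists>p T. p A < \<eta> \<and> (\<forall>t\<ge>A. 0 < p t \<and> integral {A..t} (\<lambda>s. 1 / p s) \<le> T \<and>
      (\<exists>D. (p has_real_derivative D) (at t) \<and> max (p t * D) 0 + 1 / (4 * B) * p t \<le> f t + g t * p t powr q))"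
    proof (rule exI[of _ "p e"], rule exI[of _ "1 / e * T"], intro conjI allI impI)
      have "(e * G A) powr (2 * \<alpha>) \<le> e * G A powr (2 * \<alpha>)"
      proof -
        have "e powr (2 * \<alpha>) \<le> e powr 1" using e \<alpha> by (intro powr_mono') auto
        then show ?thesis using e FGp[of A] by (simp add: powr_mult mult_right_mono)
      qed
      then have "w e A \<le> e * w 1 A" by (simp add: w_def distrib_left)
      also have "\<dots> \<le> (\<eta> / (2 * p 1 A))\<^sup>2 * w 1 A" using e w[of 1 A] by (intro mult_right_mono) auto
      finally have "p e A \<le> sqrt ((\<eta> / (2 * p 1 A))\<^sup>2 * w 1 A)" unfolding p_def by (rule real_sqrt_le_mono)
      also have "\<dots> = \<eta> / (2 * p 1 A) * p 1 A"
        using \<eta> pA by (simp add: real_sqrt_mult p_def[of 1 A, symmetric])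
      also have "\<dots> < \<eta>" using pA \<eta> by simp
      finally show "p e A < \<eta>" .
      fix t assume t: "A \<le> t"
      show pt: "0 < p e t" by (rule p[OF e(1) t])
      have "integral {A..t} (\<lambda>s. 1 / p e s) \<le> integral {A..t} (\<lambda>s. 1 / e * (1 / p 1 s))"
      proof (rule integral_le)
        show "(\<lambda>s. 1 / p e s) integrable_on {A..t}"
          by (intro integrable_continuous_interval continuous_intros continuous_on_subset[OF cp[OF e(1)]])
            (use p[OF e(1)] in force)+
        show "(\<lambda>s. 1 / e * (1 / p 1 s)) integrable_on {A..t}"
          by (intro integrable_continuous_interval continuous_intros continuous_on_subset[OF cp])
            (use p[of 1] in force)+
        fix s assume s: "s \<in> {A..t}"
        have "1 / p e s \<le> 1 / (e * p 1 s)"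
          using e_le[of e s] p[of e s] p[of 1 s] e s by (intro divide_left_mono) auto
        then show "1 / p e s \<le> 1 / e * (1 / p 1 s)" by simp
      qed
      also have "\<dots> \<le> 1 / e * T"
        unfolding Henstock_Kurzweil_Integration.integral_mult_right
        using T[OF t] e by (intro mult_left_mono) auto
      finally show "integral {A..t} (\<lambda>s. 1 / p e s) \<le> 1 / e * T" .
      define R where "R = f t + g t * p e t powr q"
      have t0: "0 < t" using A t by simp
      have eG: "0 < e * G t" using e FGp[OF t] by simp
      have "(e * G t) powr (2 * \<alpha> - 1) = ((e * G t) powr (2 * \<alpha>)) powr (q / 2)"
        unfolding \<alpha>(4) by (simp add: powr_powr mult.commute)
      also have "\<dots> \<le> w e t powr (q / 2)"
        using q e FGp[OF t] by (intro powr_mono2) (auto simp: w_def)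
      also have "\<dots> = p e t powr q"
        using w[OF e(1) t] by (simp add: p_def powr_half_sqrt[symmetric] powr_powr)
      finally have Gq: "(e * G t) powr (2 * \<alpha> - 1) \<le> p e t powr q" .
      have WR: "W e t \<le> 2 * e * R"
      proof -
        have "2 * \<alpha> * (e * G t) powr (2 * \<alpha> - 1) * (e * g t) \<le> 2 * p e t powr q * (e * g t)"
          using Gq \<alpha> e g[OF t] by (intro mult_mono) auto
        moreover have "e * f t \<le> 2 * (e * f t)" using e f_pos[of t] by simp
        ultimately show ?thesis by (simp add: W_def R_def algebra_simps)
      qed
      have wW: "w e t \<le> t * W e t"
      proof -
        have "e * F t \<le> t * (e * f t)" using FG_bounds(2)[of t] t0 e by (simp add: mult.left_commute)
        moreover have "(e * G t) powr (2 * \<alpha>) \<le> t * (2 * \<alpha> * (e * G t) powr (2 * \<alpha> - 1) * (e * g t))"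
        proof -
          have "(e * G t) powr (2 * \<alpha>) = (e * G t) powr (2 * \<alpha> - 1) * (e * G t)"
            using eG powr_add[of "e * G t" "2 * \<alpha> - 1" 1] by simp
          also have "\<dots> \<le> (e * G t) powr (2 * \<alpha> - 1) * (e * (t * g t))"
            using FG_bounds(4)[of t] t0 e g[OF t] by (intro mult_left_mono) (auto simp: max_def)
          also have "\<dots> \<le> (2 * \<alpha>) * ((e * G t) powr (2 * \<alpha> - 1) * (e * (t * g t)))"
            using \<alpha>(3) e t0 g[OF t] mult_right_mono[of 1 "2 * \<alpha>" "(e * G t) powr (2 * \<alpha> - 1) * (e * (t * g t))"] by simp
          finally show ?thesis by (simp only: mult_ac)
        qed
        ultimately show ?thesis by (simp add: w_def W_def distrib_left)
      qed
      have R0: "0 \<le> R" using f_pos[of t] g[OF t] by (simp add: R_def)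
      \<comment> \<open>Here \<open>e\<close> cancels: \<open>w e t \<le> t * W e t\<close>,
        \<open>t \<le> B * p 1 t \<le> B * (p e t / e)\<close> and
        \<open>W e t \<le> 2 * e * R\<close>. This is why \<open>\<kappa> = 1 / (4 * B)\<close>
        suits every \<open>\<eta>\<close>.\<close>
      have "p e t \<le> 2 * B * R"
      proof -
        have "p 1 t \<le> p e t / e" using e_le[of e t] e t by (simp add: field_simps)
        then have "B * p 1 t \<le> B * (p e t / e)" using B(1) by (intro mult_left_mono) auto
        then have "t \<le> B * (p e t / e)" using B(2)[OF t] by simp
        then have "t * W e t \<le> B * (p e t / e) * (2 * e * R)"
          using W0[OF e(1) t] WR t0 by (intro mult_mono) auto
        also have "\<dots> = p e t * (2 * B * R)" using e by simp
        finally have "p e t * p e t \<le> p e t * (2 * B * R)"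
          using wW w[OF e(1) t] by (simp add: p_def)
        then show ?thesis by (rule mult_left_le_imp_le) (rule pt)
      qed
      then have k: "1 / (4 * B) * p e t \<le> R / 2" using B(1) by (simp add: field_simps)
      have "p e t * (inverse (p e t) / 2 * W e t) = W e t / 2" using pt by simp
      also have "\<dots> \<le> e * R" using WR by simp
      also have "\<dots> \<le> R / 2" using e R0 mult_right_mono[of e "1 / 2" R] by simp
      finally have "max (p e t * (inverse (p e t) / 2 * W e t)) 0 \<le> R / 2" using R0 by simp
      then have "max (p e t * (inverse (p e t) / 2 * W e t)) 0 + 1 / (4 * B) * p e t \<le> f t + g t * p e t powr q"
        using k by (simp add: R_def[symmetric])
      then show "\<exists>D. (p e has_real_derivative D) (at t) \<and> max (p e t * D) 0 + 1 / (4 * B) * p e t \<le> f t + g t * p e t powr q"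
        using dp[OF e(1) t] by blast
    qed
  qed (use B in simp)
qed

end

section \<open>The three equivalences\<close>

theorem theorem3p3:
  fixes f g :: "real \<Rightarrow> real" and q :: real and L :: ereal
  assumes "0 < q" "q \<le> 2"
    and "continuous_on UNIV f" "continuous_on UNIV g"
    and "mono f" "mono g"
    and "\<forall>t. 0 < f t" "strict_mono f"
    and "((\<lambda>t. ereal (g t)) \<longlongrightarrow> L) at_top"
  shows
   "(0 < L \<longrightarrow>
      ((\<exists>u :: real^'n \<Rightarrow> real. visc_subsol f g q u) \<longleftrightarrow>
        q \<le> 1 \<and>
        (\<integral>\<^sup>+ t\<in>{0..}. ennreal (1 / (sqrt (t * f t) + (t * max (g t) 0) powr (1 / (2 - q)))) \<partial>lborel)
          = \<infinity>)) \<and>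
    (L = 0 \<longrightarrow>
      ((\<exists>u :: real^'n \<Rightarrow> real. visc_subsol f g q u) \<longleftrightarrow>
        (\<integral>\<^sup>+ t\<in>{0..}. ennreal (1 / sqrt (integral {0..t} (\<lambda>s.
            exp (- 2 * integral {s..t} (\<lambda>\<tau>. (max (- g \<tau>) 0 / f \<tau>) powr (2 / q) * f \<tau>)) * f s)))
          \<partial>lborel) = \<infinity>)) \<and>
    (L < 0 \<longrightarrow>
      ((\<exists>u :: real^'n \<Rightarrow> real. visc_subsol f g q u) \<longleftrightarrow>
        (\<integral>\<^sup>+ t\<in>{0..}. ennreal (1 / sqrt (t * f t) + 1 / f t powr (1 / q)) \<partial>lborel) = \<infinity>))"
proof -
  have q: "0 < q" "q \<le> 2" and f_cont: "continuous_on UNIV f" and g_cont: "continuous_on UNIV g"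
    and g_mono: "mono g" and f_pos: "\<And>t. 0 < f t" and f_mono: "strict_mono f"
    and lim: "((\<lambda>t. ereal (g t)) \<longlongrightarrow> L) at_top"
    using assms by auto
  \<comment> \<open>Being nondecreasing, \<open>g\<close> stays below its limit;
    \<open>L \<le> 0\<close> therefore gives \<open>g \<le> 0\<close> on the whole line.\<close>
  have g_le: "ereal (g t) \<le> L" for t
  proof (rule tendsto_lowerbound[OF lim])
    show "\<forall>\<^sub>F s in at_top. ereal (g t) \<le> ereal (g s)"
      using eventually_ge_at_top[of t] by eventually_elim (use monoD[OF g_mono] in simp)
  qed simp
  let ?u = "\<lambda>u :: real^'n \<Rightarrow> real. visc_subsol f g q u"
  have pos: "(\<exists>u. ?u u) \<longleftrightarrow> q \<le> 1 \<and>
      (\<integral>\<^sup>+ t\<in>{0..}. ennreal (1 / (sqrt (t * f t) + (t * max (g t) 0) powr (1 / (2 - q)))) \<partial>lborel) = \<infinity>"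
    if L: "0 < L"
  proof -
    have "\<forall>\<^sub>F t in at_top. 0 < ereal (g t)" by (rule order_tendstoD(1)[OF lim L])
    then have "\<forall>\<^sub>F t in at_top. 1 \<le> t \<and> 0 < g t"
      using eventually_ge_at_top[of 1] by eventually_elim simp
    then obtain A where A: "1 \<le> A" "0 < g A" by (metis (mono_tags, lifting) eventually_happens trivial_limit_at_top_linorder)
    show ?thesis
    proof (cases "q \<le> 1")
      case True
      interpret sublinear_gradient_term f g q
        by unfold_locales (use q True f_cont g_cont f_mono g_mono f_pos in auto)
      have "(\<exists>u. ?u u) \<longleftrightarrow> (\<integral>\<^sup>+ t\<in>{0..}. ennreal (h t) \<partial>lborel) = \<infinity>"
        using exists_subsol no_subsol[OF _ A] by blast
      then show ?thesis using True unfolding h_def \<alpha>_def by blast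
    next
      case False
      then have "\<not> ?u u" for u
        by (intro no_subsol_superlinear_gradient[OF _ f_mono f_pos g_mono A(2)]) simp
      then show ?thesis using False by blast
    qed
  qed
  \<comment> \<open>For every \<open>L \<le> 0\<close>, existence is equivalent to divergence of the
    integral of \<open>1 / sqrt w\<close>. For \<open>L < 0\<close> a second integrand is compared
    with this one, in both directions.\<close>
  have nonpos: "((\<exists>u. ?u u) \<longleftrightarrow>
      (\<integral>\<^sup>+ t\<in>{0..}. ennreal (1 / sqrt (integral {0..t} (\<lambda>s.
          exp (- 2 * integral {s..t} (\<lambda>\<tau>. (max (- g \<tau>) 0 / f \<tau>) powr (2 / q) * f \<tau>)) * f s)))
        \<partial>lborel) = \<infinity>) \<and>
      (L < 0 \<longrightarrow> ((\<exists>u. ?u u) \<longleftrightarrow>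
        (\<integral>\<^sup>+ t\<in>{0..}. ennreal (1 / sqrt (t * f t) + 1 / f t powr (1 / q)) \<partial>lborel) = \<infinity>))"
    if L: "L \<le> 0"
  proof -
    have g_nonpos: "g t \<le> 0" for t using order_trans[OF g_le L, of t] by simp
    interpret nonpos_gradient_term f g q
      by unfold_locales (use q f_cont g_cont f_mono g_mono f_pos g_nonpos in auto)
    let ?p = "\<lambda>t. 2 * sqrt (w t)"
    have c: "continuous_on {1..} (\<lambda>t. sqrt (w t))" by (intro continuous_intros w_cont)
    have c2: "continuous_on {1..} ?p" by (intro continuous_intros w_cont)
    have p: "0 < sqrt (w t)" "0 < ?p t" if "1 \<le> t" for t using w_pos[of t] that by auto
    have "(\<exists>u. ?u u) \<longleftrightarrow> (\<integral>\<^sup>+ t\<in>{0..}. ennreal (1 / sqrt (w t)) \<partial>lborel) = \<infinity>" (is "_ \<longleftrightarrow> ?I = \<infinity>")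
    proof
      assume I: "?I = \<infinity>"
      have "\<exists>t\<ge>1. c \<le> integral {1..t} (\<lambda>s. 1 / ?p s)" for c
        by (rule integral_unbounded_of_nn_integral_infinite[where K = 2, OF I w_near c2 p(2)])
          (use f_pos[of 0] in auto)
      then show "\<exists>u. ?u u" by (rule exists_subsol)
    next
      assume ex: "\<exists>u. ?u u"
      show "?I = \<infinity>"
      proof (rule ccontr)
        assume "?I \<noteq> \<infinity>"
        then have "\<exists>T. \<forall>t\<ge>1. integral {1..t} (\<lambda>s. 1 / sqrt (w s)) \<le> T"
          by (rule integral_bounded_of_nn_integral_finite[where K = 1, OF _ c p(1)]) auto
        then show False using no_subsol ex by blast
      qed
    qed
    moreover have "(\<exists>u. ?u u) \<longleftrightarrow>
        (\<integral>\<^sup>+ t\<in>{0..}. ennreal (1 / sqrt (t * f t) + 1 / f t powr (1 / q)) \<partial>lborel) = \<infinity>" (is "_ \<longleftrightarrow> ?I = \<infinity>")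
      if "L < 0"
    proof
      \<comment> \<open>The comparison needs a real negative upper bound for \<open>g\<close>, while
        \<open>L\<close> is an \<open>ereal\<close>; any \<open>l\<close> strictly between
        \<open>L\<close> and 0 serves.\<close>
      obtain l where l: "L < ereal l" "l < 0" using ereal_dense2[OF \<open>L < 0\<close>] by auto
      have gl: "g t \<le> - (- l)" for t using order_le_less_trans[OF g_le l(1), of t] by simp
      assume I: "?I = \<infinity>"
      let ?K = "2 * (1 + 1 / (- l) powr (1 / q))"
      let ?C = "1 / sqrt (f 0) + 1 / f 0 powr (1 / q)"
      have "\<exists>t\<ge>1. c \<le> integral {1..t} (\<lambda>s. 1 / ?p s)" for c
      proof (rule integral_unbounded_of_nn_integral_infinite[where K = ?K and C = ?C, OF I _ c2 p(2)])
        fix t :: real assume t: "0 \<le> t" "t \<le> 1"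
        have f0: "0 < f 0" "f 0 \<le> f t" using f_pos f_le t by auto
        have "1 / sqrt (t * f t) \<le> 1 / sqrt (f 0) * t powr (- 1 / 2)"
        proof (cases "t = 0")
          case False
          then have t0: "0 < t" using t by simp
          have "1 / sqrt (t * f t) \<le> 1 / sqrt (t * f 0)"
            using t0 f0 by (intro divide_left_mono) auto
          also have "\<dots> = 1 / sqrt (f 0) * t powr (- 1 / 2)"
            unfolding inverse_sqrt_powr[OF t0, symmetric] by (simp add: real_sqrt_mult)
          finally show ?thesis .
        qed simp
        also have "\<dots> \<le> ?C * t powr (- 1 / 2)" by (intro mult_right_mono) auto
        finally have 1: "1 / sqrt (t * f t) \<le> ?C * t powr (- 1 / 2)" .
        have "1 / f t powr (1 / q) \<le> 1 / f 0 powr (1 / q)"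
          using f0 q by (intro divide_left_mono powr_mono2) auto
        also have "\<dots> \<le> ?C * 1" using f0 by simp
        finally show "1 / sqrt (t * f t) + 1 / f t powr (1 / q) \<le> ?C * (t powr (- 1 / 2) + 1)"
          using 1 by (simp only: distrib_left)
      next
        fix t :: real assume "1 \<le> t"
        then show "1 / sqrt (t * f t) + 1 / f t powr (1 / q) \<le> ?K * (1 / ?p t)"
          by (intro w_upper_of_neg gl) (use l in auto)
      qed (use f_pos[of 0] in \<open>auto intro!: add_pos_nonneg\<close>)
      then show "\<exists>u. ?u u" by (rule exists_subsol)
    next
      assume ex: "\<exists>u. ?u u"
      show "?I = \<infinity>"
      proof (rule ccontr)
        assume I: "?I \<noteq> \<infinity>"
        let ?K = "exp 1 * (1 + sqrt (max (- g 0) 0 powr (2 / q) + 1))"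
        have [measurable]: "f \<in> borel_measurable borel" using f_cont by (rule borel_measurable_continuous_onI)
        have "(\<lambda>t. 1 / sqrt (t * f t) + 1 / f t powr (1 / q)) \<in> borel_measurable borel" by measurable
        from nn_integral_rescale_finite[OF I this]
        have "\<exists>T. \<forall>t\<ge>1. integral {1..t} (\<lambda>s. 1 / sqrt (w s)) \<le> T"
        proof (rule integral_bounded_of_nn_integral_finite[where K = ?K, OF _ c p(1)])
          fix t :: real assume "1 \<le> t"
          then show "1 / sqrt (w t) \<le> ?K * (1 / sqrt (t / 2 * f (t / 2)) + 1 / f (t / 2) powr (1 / q))"
            by (intro w_lower_half assms(2)) simp
        qed (auto intro!: mult_pos_pos add_pos_nonneg)
        then show False using no_subsol ex by blast
      qed
    qed
    ultimately show ?thesis unfolding w_def b_def by blast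
  qed
  show ?thesis
  proof (intro conjI impI)
    assume "0 < L"
    then show "(\<exists>u. ?u u) \<longleftrightarrow> q \<le> 1 \<and>
      (\<integral>\<^sup>+ t\<in>{0..}. ennreal (1 / (sqrt (t * f t) + (t * max (g t) 0) powr (1 / (2 - q)))) \<partial>lborel) = \<infinity>"
      by (rule pos)
  next
    assume "L = 0"
    then have "L \<le> 0" by simp
    from nonpos[OF this, THEN conjunct1] show "(\<exists>u. ?u u) \<longleftrightarrow>
      (\<integral>\<^sup>+ t\<in>{0..}. ennreal (1 / sqrt (integral {0..t} (\<lambda>s.
          exp (- 2 * integral {s..t} (\<lambda>\<tau>. (max (- g \<tau>) 0 / f \<tau>) powr (2 / q) * f \<tau>)) * f s)))
        \<partial>lborel) = \<infinity>" .
  next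
    assume "L < 0"
    then have "L \<le> 0" by simp
    from nonpos[OF this, THEN conjunct2] \<open>L < 0\<close> show "(\<exists>u. ?u u) \<longleftrightarrow>
      (\<integral>\<^sup>+ t\<in>{0..}. ennreal (1 / sqrt (t * f t) + 1 / f t powr (1 / q)) \<partial>lborel) = \<infinity>"
      by (rule mp)
  qed
qed

end
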